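(* The vector lattice $\mathcal B_T^r(H)$ is Dedekind complete. More precisely, if $(S_\alpha)$ is an increasing net in $\mathcal B_T^r(H)$ which is bounded above in $\mathcal B_T^r(H)$ and $S=\sup_\alpha S_\alpha$ (supremum in $\mathcal B_T^r(H)$), then for every $x\in H_+$, $$Sx=\sup_\alpha S_\alpha x.$$ The analogous statement holds for decreasing nets and infima: if $(S_\alpha)$ is a decreasing net in $\mathcal B_T^r(H)$ bounded below in $\mathcal B_T^r(H)$ and $S=\inf_\alpha S_\alpha$, then $Sx=\inf_\alpha S_\alpha x$ for every $x\in H_+$. For an arbitrary nonempty family in $\mathcal B_T^r(H)$ bounded above in $\mathcal B_T^r(H)$, its supremum is the supremum of the directed net of its finite suprema.
   Context: Setting. All spaces are real. $E$ is a Dedekind complete Riesz space with weak order unit $e$. $T:E\to E$ is a conditional expectation operator, i.e. a positive order-continuous linear projection whose range is a Dedekind complete Riesz subspace and which maps weak order units to weak order units; it satisfies $Te=e$ and is strictly positive ($x\ge 0$ and $Tx=0$ imply $x=0$). $E^u$ is the universal completion of $E$, with its $f$-algebra multiplication having unit $e$. $L^1(T)\subseteq E^u$ is the natural domain of $T$: the set of differences $f_1-f_2$ with $f_i\in E^u_+$ such that there is a net $(f_\alpha)$ in $E_+$ with $f_\alpha\uparrow f_i$ in $E^u$ and $(Tf_\alpha)$ bounded above in $E^u$; $T$ is extended to $L^1(T)$ by $Tf_i=\sup_\alpha Tf_\alpha$, and the extension, still denoted $T$, is again a strictly positive conditional expectation on $L^1(T)$ with $Te=e$. $A:=R(T)$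 is the range of the (extended) $T$; it is a Dedekind complete unital Archimedean $f$-algebra with unit $e$, and $T(az)=aT(z)$ for $a\in A$ whenever the products are defined. $H:=L^2(T)=\{x\in L^1(T):x^2\in L^1(T)\}$ with the inherited order is a Dedekind complete Riesz space and an $A$-module. For $x,y\in H$, $\langle x,y\rangle_T:=T(xy)\in A$ and $\|x\|_{T,2}:=(T(x^2))^{1/2}\in A_+$ (the positive square root in $A$). Definitions. $\mathcal B_T(H)$ is the set of $A$-linear (additive and $A$-homogeneous) maps $S:H\to H$ that are $T$-strongly bounded: there is $k\in A_+$ with $\|Sx\|_{T,2}\le k\|x\|_{T,2}$ for all $x\in H$. An operator $S$ on $H$ is order positive if $x\ge0$ implies $Sx\ge0$; $R\le Q$ means that $Q-R$ is order positive. $\mathcal B_T(H)_+$ is the set of order-positive operators in $\mathcal B_T(H)$, and $\mathcal B_T^r(H):=\mathcal B_T(H)_+-\mathcal B_T(H)_+$ (the $T$-regular operators), which is a vector lattice for this order. *)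

theory Defs
  imports "HOL-Analysis.Analysis"
begin

text \<open>
  Order notions relative to a carrier set and an order relation, so that they apply both to
  subspaces of a Riesz space and to sets of operators.
\<close>

definition is_sup_on :: "('a \<Rightarrow> 'a \<Rightarrow> bool) \<Rightarrow> 'a set \<Rightarrow> 'a set \<Rightarrow> 'a \<Rightarrow> bool" where
  "is_sup_on le X D s \<longleftrightarrow>
     s \<in> X \<and> (\<forall>d\<in>D. le d s) \<and> (\<forall>u\<in>X. (\<forall>d\<in>D. le d u) \<longrightarrow> le s u)"

definition is_inf_on :: "('a \<Rightarrow> 'a \<Rightarrow> bool) \<Rightarrow> 'a set \<Rightarrow> 'a set \<Rightarrow> 'a \<Rightarrow> bool" where
  "is_inf_on le X D s \<longleftrightarrow>
     s \<in> X \<and> (\<forall>d\<in>D. le s d) \<and> (\<forall>u\<in>X. (\<forall>d\<in>D. le u d) \<longrightarrow> le u s)"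

definition bdd_above_on :: "('a \<Rightarrow> 'a \<Rightarrow> bool) \<Rightarrow> 'a set \<Rightarrow> 'a set \<Rightarrow> bool" where
  "bdd_above_on le X D \<longleftrightarrow> (\<exists>u\<in>X. \<forall>d\<in>D. le d u)"

definition bdd_below_on :: "('a \<Rightarrow> 'a \<Rightarrow> bool) \<Rightarrow> 'a set \<Rightarrow> 'a set \<Rightarrow> bool" where
  "bdd_below_on le X D \<longleftrightarrow> (\<exists>u\<in>X. \<forall>d\<in>D. le u d)"

definition dedekind_complete_on :: "('a \<Rightarrow> 'a \<Rightarrow> bool) \<Rightarrow> 'a set \<Rightarrow> bool" where
  "dedekind_complete_on le X \<longleftrightarrow>
     (\<forall>D. D \<subseteq> X \<and> D \<noteq> {} \<and> bdd_above_on le X D \<longrightarrow> (\<exists>s. is_sup_on le X D s))"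

definition directed_on :: "('i \<Rightarrow> 'i \<Rightarrow> bool) \<Rightarrow> 'i set \<Rightarrow> bool" where
  "directed_on le I \<longleftrightarrow>
     I \<noteq> {} \<and> (\<forall>i\<in>I. le i i) \<and>
     (\<forall>i\<in>I. \<forall>j\<in>I. \<forall>k\<in>I. le i j \<longrightarrow> le j k \<longrightarrow> le i k) \<and>
     (\<forall>i\<in>I. \<forall>j\<in>I. \<exists>k\<in>I. le i k \<and> le j k)"


text \<open>
  The \<open>f\<close>-algebra axiom below is one-sided because the multiplication is commutative (which is
  automatic for Archimedean \<open>f\<close>-algebras). No unit is built into the class, so that the
  zero space is not excluded.
\<close>

class f_algebra = real_algebra + ordered_comm_ring + ordered_real_vector + lattice +
  assumes inf_mult_eq_zero: "inf a b = 0 \<Longrightarrow> 0 \<le> c \<Longrightarrow> inf (c * a) b = 0"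

class dedekind_complete_f_algebra = f_algebra + conditionally_complete_lattice

definition riesz_subspace :: "'u::{real_vector, lattice} set \<Rightarrow> bool" where
  "riesz_subspace E \<longleftrightarrow> subspace E \<and> (\<forall>x\<in>E. \<forall>y\<in>E. sup x y \<in> E \<and> inf x y \<in> E)"

definition weak_order_unit :: "'u::{zero, lattice} set \<Rightarrow> 'u \<Rightarrow> bool" where
  "weak_order_unit E w \<longleftrightarrow> w \<in> E \<and> 0 \<le> w \<and> (\<forall>x\<in>E. 0 \<le> x \<and> inf x w = 0 \<longrightarrow> x = 0)"

text \<open>
  The whole type is a universal completion of \<open>E\<close>: it is Dedekind complete (by its class) and
  laterally complete, and \<open>E\<close> is an order dense Riesz subspace of it.
\<close>

definition universal_completion_of :: "'u::dedekind_complete_f_algebra set \<Rightarrow> bool" where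
  "universal_completion_of E \<longleftrightarrow>
     riesz_subspace E \<and>
     (\<forall>u. 0 < u \<longrightarrow> (\<exists>x\<in>E. 0 < x \<and> x \<le> u)) \<and>
     (\<forall>D::'u set. D \<noteq> {} \<and> (\<forall>x\<in>D. 0 \<le> x) \<and> (\<forall>x\<in>D. \<forall>y\<in>D. x \<noteq> y \<longrightarrow> inf x y = 0)
        \<longrightarrow> (\<exists>s. is_sup_on (\<le>) UNIV D s))"

text \<open>
  \<open>T\<close> is a total function of which only the restriction to \<open>E\<close> is used. Monotone nets in a
  Riesz space are represented by their ranges: an upward (downward) directed set is a net indexed
  by itself, and conversely only the range of a monotone net enters its supremum (infimum).
\<close>

locale riesz_conditional_expectation =
  fixes E :: "'u::dedekind_complete_f_algebra set" and e :: 'u and T :: "'u \<Rightarrow> 'u"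
  assumes universal_completion: "universal_completion_of E"
    and dedekind_complete: "dedekind_complete_on (\<le>) E"
    and weak_unit: "weak_order_unit E e"
    and mult_unit: "e * x = x"
    and maps_to: "x \<in> E \<Longrightarrow> T x \<in> E"
    and add: "x \<in> E \<Longrightarrow> y \<in> E \<Longrightarrow> T (x + y) = T x + T y"
    and scale: "x \<in> E \<Longrightarrow> T (c *\<^sub>R x) = c *\<^sub>R T x"
    and positive: "x \<in> E \<Longrightarrow> 0 \<le> x \<Longrightarrow> 0 \<le> T x"
    and projection: "x \<in> E \<Longrightarrow> T (T x) = T x"
    and order_continuous:
      "D \<subseteq> E \<Longrightarrow> directed_on (\<ge>) D \<Longrightarrow> is_inf_on (\<le>) E D 0 \<Longrightarrow> is_inf_on (\<le>) E (T ` D) 0"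
    and range_riesz_subspace: "riesz_subspace (T ` E)"
    and range_dedekind_complete: "dedekind_complete_on (\<le>) (T ` E)"
    and maps_weak_units: "weak_order_unit E w \<Longrightarrow> weak_order_unit E (T w)"
    and fixes_unit: "T e = e"
    and strictly_positive: "x \<in> E \<Longrightarrow> 0 \<le> x \<Longrightarrow> T x = 0 \<Longrightarrow> x = 0"


text \<open>\<open>D\<close> is (the range of) a net in \<open>E\<^sub>+\<close> which increases to \<open>f\<close> in the universal completion
  and whose image under \<open>T\<close> is bounded above there.\<close>

definition approximating_net ::
    "'u::dedekind_complete_f_algebra set \<Rightarrow> ('u \<Rightarrow> 'u) \<Rightarrow> 'u \<Rightarrow> 'u set \<Rightarrow> bool" where
  "approximating_net E T f D \<longleftrightarrow>
     D \<subseteq> E \<and> (\<forall>x\<in>D. 0 \<le> x) \<and> directed_on (\<le>) D \<and> is_sup_on (\<le>) UNIV D f \<and> bdd_above (T ` D)"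

definition natural_cone :: "'u::dedekind_complete_f_algebra set \<Rightarrow> ('u \<Rightarrow> 'u) \<Rightarrow> 'u set" where
  "natural_cone E T = {f. 0 \<le> f \<and> (\<exists>D. approximating_net E T f D)}"

definition L1 :: "'u::dedekind_complete_f_algebra set \<Rightarrow> ('u \<Rightarrow> 'u) \<Rightarrow> 'u set" where
  "L1 E T = {f1 - f2 | f1 f2. f1 \<in> natural_cone E T \<and> f2 \<in> natural_cone E T}"

definition cone_extension ::
    "'u::dedekind_complete_f_algebra set \<Rightarrow> ('u \<Rightarrow> 'u) \<Rightarrow> 'u \<Rightarrow> 'u" where
  "cone_extension E T f =
     (THE y. \<exists>D. approximating_net E T f D \<and> is_sup_on (\<le>) UNIV (T ` D) y)"

definition extended ::
    "'u::dedekind_complete_f_algebra set \<Rightarrow> ('u \<Rightarrow> 'u) \<Rightarrow> 'u \<Rightarrow> 'u" where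
  "extended E T f =
     (THE y. \<exists>f1 f2. f1 \<in> natural_cone E T \<and> f2 \<in> natural_cone E T \<and> f = f1 - f2 \<and>
        y = cone_extension E T f1 - cone_extension E T f2)"

definition range_algebra ::
    "'u::dedekind_complete_f_algebra set \<Rightarrow> ('u \<Rightarrow> 'u) \<Rightarrow> 'u set" where
  "range_algebra E T = extended E T ` L1 E T"

definition L2 :: "'u::dedekind_complete_f_algebra set \<Rightarrow> ('u \<Rightarrow> 'u) \<Rightarrow> 'u set" where
  "L2 E T = {x \<in> L1 E T. x * x \<in> L1 E T}"

definition norm_T2 ::
    "'u::dedekind_complete_f_algebra set \<Rightarrow> ('u \<Rightarrow> 'u) \<Rightarrow> 'u \<Rightarrow> 'u" where
  "norm_T2 E T x =
     (THE r. r \<in> range_algebra E T \<and> 0 \<le> r \<and> r * r = extended E T (x * x))"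


text \<open>
  A map \<open>S : H \<rightarrow> H\<close> on \<open>H = L2 E T\<close> is represented by the total function that agrees with it on
  \<open>H\<close> and vanishes outside \<open>H\<close>; equal operators are thus equal functions, and pointwise
  addition, subtraction and scaling of representatives are the operations on operators.
\<close>

definition bounded_ops ::
    "'u::dedekind_complete_f_algebra set \<Rightarrow> ('u \<Rightarrow> 'u) \<Rightarrow> ('u \<Rightarrow> 'u) set" where
  "bounded_ops E T =
     {S. (\<forall>x. x \<notin> L2 E T \<longrightarrow> S x = 0) \<and>
         (\<forall>x\<in>L2 E T. S x \<in> L2 E T) \<and>
         (\<forall>x\<in>L2 E T. \<forall>y\<in>L2 E T. S (x + y) = S x + S y) \<and>
         (\<forall>a\<in>range_algebra E T. \<forall>x\<in>L2 E T. S (a * x) = a * S x) \<and>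
         (\<exists>k\<in>range_algebra E T. 0 \<le> k \<and>
            (\<forall>x\<in>L2 E T. norm_T2 E T (S x) \<le> k * norm_T2 E T x))}"

definition order_positive ::
    "'u::dedekind_complete_f_algebra set \<Rightarrow> ('u \<Rightarrow> 'u) \<Rightarrow> ('u \<Rightarrow> 'u) \<Rightarrow> bool" where
  "order_positive E T S \<longleftrightarrow> (\<forall>x\<in>L2 E T. 0 \<le> x \<longrightarrow> 0 \<le> S x)"

definition op_le ::
    "'u::dedekind_complete_f_algebra set \<Rightarrow> ('u \<Rightarrow> 'u) \<Rightarrow> ('u \<Rightarrow> 'u) \<Rightarrow> ('u \<Rightarrow> 'u) \<Rightarrow> bool" where
  "op_le E T R Q \<longleftrightarrow> order_positive E T (\<lambda>x. Q x - R x)"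

definition positive_ops ::
    "'u::dedekind_complete_f_algebra set \<Rightarrow> ('u \<Rightarrow> 'u) \<Rightarrow> ('u \<Rightarrow> 'u) set" where
  "positive_ops E T = {S \<in> bounded_ops E T. order_positive E T S}"

definition regular_ops ::
    "'u::dedekind_complete_f_algebra set \<Rightarrow> ('u \<Rightarrow> 'u) \<Rightarrow> ('u \<Rightarrow> 'u) set" where
  "regular_ops E T = {(\<lambda>x. P x - Q x) | P Q. P \<in> positive_ops E T \<and> Q \<in> positive_ops E T}"

text \<open>\<open>B\<close> with pointwise operations and the order \<open>le\<close> is a vector lattice.\<close>

definition operator_vector_lattice ::
    "(('u \<Rightarrow> 'u) \<Rightarrow> ('u \<Rightarrow> 'u) \<Rightarrow> bool) \<Rightarrow> ('u \<Rightarrow> 'u::real_vector) set \<Rightarrow> bool" where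
  "operator_vector_lattice le B \<longleftrightarrow>
     (\<lambda>x. 0) \<in> B \<and>
     (\<forall>R\<in>B. \<forall>Q\<in>B. (\<lambda>x. R x + Q x) \<in> B) \<and>
     (\<forall>c::real. \<forall>R\<in>B. (\<lambda>x. c *\<^sub>R R x) \<in> B) \<and>
     (\<forall>R\<in>B. le R R) \<and>
     (\<forall>R\<in>B. \<forall>Q\<in>B. le R Q \<longrightarrow> le Q R \<longrightarrow> R = Q) \<and>
     (\<forall>R\<in>B. \<forall>Q\<in>B. \<forall>V\<in>B. le R Q \<longrightarrow> le Q V \<longrightarrow> le R V) \<and>
     (\<forall>R\<in>B. \<forall>Q\<in>B. \<forall>V\<in>B. le R Q \<longrightarrow> le (\<lambda>x. R x + V x) (\<lambda>x. Q x + V x)) \<and>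
     (\<forall>c::real. \<forall>R\<in>B. \<forall>Q\<in>B. 0 \<le> c \<longrightarrow> le R Q \<longrightarrow> le (\<lambda>x. c *\<^sub>R R x) (\<lambda>x. c *\<^sub>R Q x)) \<and>
     (\<forall>R\<in>B. \<forall>Q\<in>B. (\<exists>V. is_sup_on le B {R, Q} V) \<and> (\<exists>V. is_inf_on le B {R, Q} V))"

text \<open>The set of suprema of the nonempty finite subsets of \<open>F\<close>.\<close>

definition finite_sups :: "('a \<Rightarrow> 'a \<Rightarrow> bool) \<Rightarrow> 'a set \<Rightarrow> 'a set \<Rightarrow> 'a set" where
  "finite_sups le X F = {V. \<exists>G. finite G \<and> G \<noteq> {} \<and> G \<subseteq> F \<and> is_sup_on le X G V}"

end

theory Submission
  imports Defs "HOL-Library.Lattice_Algebras"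
begin

text \<open>
  The supremum of an upward directed set of regular operators is computed pointwise on the positive
  cone of \<open>H = L\<^sup>2(T)\<close>. It lies between a member of the set and an upper bound, and domination by a
  positive operator transfers \<open>T\<close>-strong boundedness. The supremum of two operators is given
  by the Riesz--Kantorovich formula, and a general family reduces to the directed set of its finite
  suprema; \<open>A\<close>-homogeneity of these suprema rests on the order continuity of multiplication and on
  division by \<open>a + \<epsilon>\<close> in the universal completion.

  The square root required by the norm is an infimum of affine functions, so \<open>Tr \<le> r\<close> whenever
  \<open>r\<^sup>2 = b\<close> and \<open>Tb = b\<close>; as \<open>T(r - Tr) = 0\<close>, strict positivity gives \<open>Tr = r\<close>.
\<close>

section \<open>Dedekind complete f-algebras with unit\<close>

\<comment> \<open>Elements of the range algebra may be unbounded relative to \<open>e\<close>: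
  multiplication by such an \<open>a\<close> is not dominated by a real multiple, and
  \<open>a * x\<close> may leave \<open>H\<close>. Order continuity of multiplication, division and
  square roots are therefore obtained by comparing with real multiples of \<open>e\<close>; what
  exceeds the level \<open>t\<close> is controlled by a power of the element divided by
  \<open>t\<close>, and the Archimedean property removes the error.

  The norm is a definite description, so no estimate is available before roots are known to exist in
  the range algebra and to be unique. After that, norm bounds are proved as inequalities between
  squares.

  Both \<open>L1 E T\<close> and \<open>H\<close> are order ideals of the whole type. A supremum
  formed in the type and caught between \<open>0\<close> and an element of \<open>H\<close> thus
  stays in \<open>H\<close>, which is why suprema of operators can be formed value by value.\<close>
subclass (in f_algebra) lattice_ab_group_add ..

text \<open>As simplification rules these turn \<open>x - inf x d\<close> into a supremum of
  negatives. The arguments below need such differences intact, as nonnegative remainders.\<close>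

declare neg_inf_eq_sup [simp del] neg_sup_eq_inf [simp del]
  diff_inf_eq_sup [simp del] diff_sup_eq_inf [simp del]

section \<open>Positive parts and disjointness in lattice-ordered groups\<close>

lemma diff_pprts: "(x::'a::lattice_ab_group_add) = pprt x - pprt (- x)"
  using prts[of x] pprt_neg[of x] by simp

text \<open>Adding \<open>pprt (- x)\<close> to \<open>inf x 0\<close> produces the left-hand side,
  and \<open>inf x 0\<close> is exactly the negative of \<open>pprt (- x)\<close>.\<close>

lemma inf_pprts: "inf (pprt x) (pprt (- x)) = (0::'a::lattice_ab_group_add)"
proof -
  have "inf (x + pprt (- x)) (0 + pprt (- x)) = nprt x + pprt (- x)"
    by (simp only: add_inf_distrib_right[symmetric] nprt_def)
  moreover have "x + pprt (- x) = pprt x" using diff_pprts[of x] by (metis diff_add_cancel)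
  ultimately show ?thesis using pprt_neg[of x] by simp
qed

text \<open>\<open>sup x (- x)\<close> serves as the absolute value throughout. Disjoint elements
  have their sum as supremum, and the zeros inside the positive parts are absorbed because
  \<open>sup x (- x)\<close> is nonnegative.\<close>

lemma sup_uminus_eq_pprts: "sup x (- x) = pprt x + pprt (- (x::'a::lattice_ab_group_add))"
proof -
  have "sup (pprt x) (pprt (- x)) = pprt x + pprt (- x)"
    using add_eq_inf_sup[of "pprt x" "pprt (- x)"] inf_pprts[of x] by simp
  moreover have "0 \<le> sup x (- x)"
  proof -
    have "x + (- x) \<le> sup x (- x) + sup x (- x)" by (rule add_mono) auto
    then show ?thesis by simp
  qed
  ultimately show ?thesis
    unfolding pprt_def by (simp add: sup_aci sup.absorb2)
qed

lemma sup_uminus_nonneg: "0 \<le> sup x (- (x::'a::lattice_ab_group_add))"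
  unfolding sup_uminus_eq_pprts by simp

text \<open>The right-hand side is the infimum of the four sums \<open>a + b\<close>,
  \<open>a + c\<close>, \<open>c + b\<close> and \<open>c + c\<close>, each of which dominates the
  left-hand side.\<close>

lemma inf_add_le:
  fixes a b c :: "'a::lattice_ab_group_add"
  assumes "0 \<le> a" "0 \<le> b" "0 \<le> c"
  shows "inf (a + b) c \<le> inf a c + inf b c"
proof -
  have "inf a c + inf b c = inf (inf (a + b) (a + c)) (inf (c + b) (c + c))"
    by (simp add: add_inf_distrib_left add_inf_distrib_right inf_aci)
  moreover have "inf (a + b) c \<le> a + c" "inf (a + b) c \<le> c + b" "inf (a + b) c \<le> c + c"
    using assms by (auto intro!: le_infI2 simp: add_increasing add_increasing2)
  ultimately show ?thesis by simp
qed

text \<open>The decomposition into disjoint parts is unique; this identifies the positive part of a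
  product in \<open>pprt_mult_le\<close>.\<close>

lemma pprt_diff_disjoint:
  fixes u v :: "'a::lattice_ab_group_add"
  assumes "inf u v = 0"
  shows "pprt (u - v) = u"
proof -
  have "pprt (u - v) + v = sup u v"
    unfolding pprt_def by (simp add: add_sup_distrib_right)
  also have "\<dots> = u + v" using add_eq_inf_sup[of u v] assms by simp
  finally show ?thesis by simp
qed

lemma mult_disjoint:
  fixes a b :: "'a::f_algebra"
  assumes "inf a b = 0"
  shows "a * b = 0"
proof -
  have "0 \<le> a" "0 \<le> b" using assms by (metis inf_le1, metis inf_le2)
  \<comment> \<open>The axiom is applied once to each factor; by commutativity the product becomes
    disjoint from itself.\<close>
  then have "inf (b * a) b = 0" using assms inf_mult_eq_zero by blast
  then have "inf (a * b) (b * a) = 0"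
    using inf_mult_eq_zero[of b "b * a" a] \<open>0 \<le> a\<close> by (simp add: inf_commute)
  then show ?thesis by (simp add: mult.commute)
qed

lemma inf_mult_mult_eq_zero:
  fixes a b c d :: "'a::f_algebra"
  assumes "inf a b = 0" "0 \<le> c" "0 \<le> d"
  shows "inf (c * a) (d * b) = 0"
proof -
  have "inf (c * a) b = 0" using assms inf_mult_eq_zero by blast
  then show ?thesis
    using inf_mult_eq_zero[of b "c * a" d] assms by (simp add: inf_commute)
qed

text \<open>Subtracting \<open>inf a b\<close> makes the two elements disjoint, disjointness
  survives multiplication by \<open>c\<close>, and translating back by \<open>c * inf a b\<close>
  gives the identity.\<close>

lemma mult_inf_distrib_left:
  fixes a b c :: "'a::f_algebra"
  assumes "0 \<le> c"
  shows "c * inf a b = inf (c * a) (c * b)"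
proof -
  have "inf (a - inf a b) (b - inf a b) = inf a b - inf a b"
    by (simp only: diff_conv_add_uminus add_inf_distrib_right)
  then have "inf (c * (a - inf a b)) (c * (b - inf a b)) = 0"
    using assms inf_mult_mult_eq_zero by (metis diff_self)
  then have "inf (c * a - c * inf a b) (c * b - c * inf a b) = 0"
    by (simp only: right_diff_distrib)
  then have "inf (c * a) (c * b) - c * inf a b = 0"
    by (simp only: diff_conv_add_uminus add_inf_distrib_right)
  then show ?thesis by simp
qed

lemma mult_sup_distrib_left:
  fixes a b c :: "'a::f_algebra"
  assumes "0 \<le> c"
  shows "c * sup a b = sup (c * a) (c * b)"
proof -
  have "c * (- inf (- a) (- b)) = - inf (c * (- a)) (c * (- b))"
    using mult_inf_distrib_left[OF assms, of "- a" "- b"] by (simp only: mult_minus_right)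
  then show ?thesis by (simp only: sup_eq_neg_inf mult_minus_right)
qed

lemma mult_pprt: "0 \<le> c \<Longrightarrow> c * pprt x = pprt (c * (x::'a::f_algebra))"
  unfolding pprt_def by (simp add: mult_sup_distrib_left)

lemma pprt_mult_pprt_uminus: "pprt x * pprt (- x) = (0::'a::f_algebra)"
  by (rule mult_disjoint) (rule inf_pprts)

lemma pprt_mult_self: "pprt x * x = pprt x * pprt (x::'a::f_algebra)"
proof -
  have "pprt x * x = pprt x * (pprt x - pprt (- x))" using diff_pprts[of x] by simp
  then show ?thesis by (simp add: right_diff_distrib pprt_mult_pprt_uminus)
qed

lemma square_eq_pprts: "x * x = pprt x * pprt x + pprt (- x) * pprt (- (x::'a::f_algebra))"
proof -
  have "x * x = (pprt x - pprt (- x)) * x"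
    using diff_pprts[of x] by simp
  also have "\<dots> = pprt x * x + pprt (- x) * (- x)" by (simp add: left_diff_distrib)
  finally show ?thesis by (simp only: pprt_mult_self)
qed

lemma square_nonneg: "0 \<le> (x::'a::f_algebra) * x"
  by (subst square_eq_pprts) (simp add: mult_nonneg_nonneg)

lemma square_sup_uminus: "sup x (- x) * sup x (- x) = x * (x::'a::f_algebra)"
  unfolding sup_uminus_eq_pprts square_eq_pprts[of x]
  using pprt_mult_pprt_uminus[of x] pprt_mult_pprt_uminus[of "- x"]
  by (simp add: distrib_left distrib_right)

lemma square_mono: "0 \<le> x \<Longrightarrow> x \<le> y \<Longrightarrow> x * x \<le> y * (y::'a::f_algebra)"
  by (meson mult_mono order_trans)

lemma two_mult_le: "2 *\<^sub>R (x * y) \<le> x * x + y * (y::'a::f_algebra)"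
  using square_nonneg[of "x - y"] by (simp add: algebra_simps scaleR_2)

lemma square_add_le: "(x + y) * (x + y) \<le> 2 *\<^sub>R (x * x + y * (y::'a::f_algebra))"
proof -
  have "(x + y) * (x + y) = x * x + y * y + 2 *\<^sub>R (x * y)"
    by (simp add: algebra_simps scaleR_2)
  then show ?thesis using two_mult_le[of x y] by (simp only: scaleR_2 add_left_mono)
qed

lemma square_le_if_bounds:
  fixes x y :: "'a::f_algebra"
  assumes "y \<le> x" "- y \<le> x"
  shows "y * y \<le> x * x"
proof -
  have "sup y (- y) * sup y (- y) \<le> x * x"
    using assms by (intro square_mono sup_uminus_nonneg) auto
  then show ?thesis by (simp add: square_sup_uminus)
qed

text \<open>Splitting both factors gives four products. The equal-sign products are disjoint from
  the mixed-sign ones, so their sum is the positive part of \<open>a * x\<close>. The bound keeps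
  products of parts in \<open>H\<close> whenever \<open>a * x\<close> is in
  \<open>H\<close>.\<close>

lemma pprt_mult_le:
  fixes a x :: "'a::f_algebra"
  shows "pprt a * pprt x \<le> pprt (a * x)"
proof -
  let ?u = "pprt a * pprt x + pprt (- a) * pprt (- x)"
  let ?v = "pprt a * pprt (- x) + pprt (- a) * pprt x"
  have ax: "a * x = ?u - ?v"
  proof -
    have "a * x = (pprt a - pprt (- a)) * (pprt x - pprt (- x))"
      using diff_pprts[of x] diff_pprts[of a] by simp
    then show ?thesis by (simp add: algebra_simps)
  qed
  have d: "inf (pprt a * pprt x) ?v \<le> 0" "inf (pprt (- a) * pprt (- x)) ?v \<le> 0"
  proof -
    have "inf (pprt a * pprt x) (pprt a * pprt (- x)) = 0"
      by (simp add: inf_mult_mult_eq_zero inf_pprts)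
    moreover have "inf (pprt a * pprt x) (pprt (- a) * pprt x) = 0"
      using inf_mult_mult_eq_zero[of "pprt a" "pprt (- a)" "pprt x" "pprt x"]
      by (simp add: inf_pprts mult.commute)
    ultimately show "inf (pprt a * pprt x) ?v \<le> 0"
      using inf_add_le[of "pprt a * pprt (- x)" "pprt (- a) * pprt x" "pprt a * pprt x"]
      by (simp add: inf_commute)
    have "inf (pprt (- a) * pprt (- x)) (pprt (- a) * pprt x) = 0"
      using inf_mult_mult_eq_zero[of "pprt x" "pprt (- x)" "pprt (- a)" "pprt (- a)"]
      by (simp add: inf_pprts inf_commute)
    moreover have "inf (pprt (- a) * pprt (- x)) (pprt a * pprt (- x)) = 0"
      using inf_mult_mult_eq_zero[of "pprt a" "pprt (- a)" "pprt (- x)" "pprt (- x)"]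
      by (simp add: inf_pprts mult.commute inf_commute)
    ultimately show "inf (pprt (- a) * pprt (- x)) ?v \<le> 0"
      using inf_add_le[of "pprt a * pprt (- x)" "pprt (- a) * pprt x" "pprt (- a) * pprt (- x)"]
      by (simp add: inf_commute)
  qed
  have "inf ?u ?v \<le> 0"
    using inf_add_le[of "pprt a * pprt x" "pprt (- a) * pprt (- x)" ?v] d
      add_mono[OF d] by simp
  then have "inf ?u ?v = 0" by (intro order.antisym) auto
  then have "pprt (a * x) = ?u" using pprt_diff_disjoint ax by metis
  then show ?thesis by simp
qed

text \<open>Adding \<open>x\<close> to one multiple gives the next, so the supremum \<open>s\<close>
  of all multiples satisfies \<open>s \<le> s - x\<close>.\<close>

lemma archimedean:
  fixes x y :: "'a::dedekind_complete_f_algebra"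
  assumes "\<And>n. real (Suc n) *\<^sub>R x \<le> y"
  shows "x \<le> 0"
proof -
  let ?R = "range (\<lambda>n. real (Suc n) *\<^sub>R x)"
  have b: "bdd_above ?R" using assms by (intro bdd_aboveI[of _ y]) (auto simp del: of_nat_Suc)
  have "Sup ?R \<le> Sup ?R - x"
  proof (rule cSup_least)
    fix z assume "z \<in> ?R"
    then obtain n where "z = real (Suc n) *\<^sub>R x" by auto
    then have "z + x = real (Suc (Suc n)) *\<^sub>R x"
      by (simp add: algebra_simps scaleR_2)
    also have "\<dots> \<le> Sup ?R" by (rule cSup_upper[OF _ b]) blast
    finally show "z \<le> Sup ?R - x" by (simp add: le_diff_eq)
  qed auto
  then show ?thesis by simp
qed

lemma archimedean_eps:
  fixes x y :: "'a::dedekind_complete_f_algebra"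
  assumes "\<And>\<epsilon>. 0 < \<epsilon> \<Longrightarrow> x \<le> \<epsilon> *\<^sub>R y"
  shows "x \<le> 0"
proof (rule archimedean)
  fix n
  have "x \<le> (1 / real (Suc n)) *\<^sub>R y" using assms by simp
  then have "real (Suc n) *\<^sub>R x \<le> real (Suc n) *\<^sub>R ((1 / real (Suc n)) *\<^sub>R y)"
    by (rule scaleR_left_mono) simp
  then show "real (Suc n) *\<^sub>R x \<le> y" by simp
qed

lemma archimedean_eps_add:
  fixes x y z :: "'a::dedekind_complete_f_algebra"
  assumes "\<And>\<epsilon>. 0 < \<epsilon> \<Longrightarrow> x \<le> z + \<epsilon> *\<^sub>R y"
  shows "x \<le> z"
  using archimedean_eps[of "x - z" y] assms by (simp add: algebra_simps)

locale unital_f_algebra =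
  fixes e :: "'u::dedekind_complete_f_algebra"
  assumes unit_mult: "e * x = x"
begin

section \<open>Truncation at multiples of the unit, order continuity of multiplication,
  division\<close>

lemma unit_mult_right [simp]: "x * e = x"
  by (subst mult.commute) (rule unit_mult)

declare unit_mult [simp]

lemma unit_nonneg: "0 \<le> e"
  using square_nonneg[of e] unit_mult by simp

lemma scaleR_unit_mult: "(t *\<^sub>R e) * x = t *\<^sub>R x" "x * (t *\<^sub>R e) = t *\<^sub>R x"
  by simp_all

text \<open>Completing the square in \<open>c * c - t *\<^sub>R (c - t *\<^sub>R e)\<close> leaves
  the surplus \<open>((3 / 4) * t * t) *\<^sub>R e\<close>. The part of \<open>c\<close> above level
  \<open>t\<close> thus tends to zero as \<open>t\<close> grows, which makes up for \<open>c\<close>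
  being unbounded.\<close>

lemma truncation_error:
  fixes c :: 'u
  assumes "0 < t"
  shows "pprt (c - t *\<^sub>R e) \<le> (1 / t) *\<^sub>R (c * c)"
proof -
  have "t *\<^sub>R (c - t *\<^sub>R e) \<le> c * c"
  proof -
    have "c * c - t *\<^sub>R (c - t *\<^sub>R e) =
      (c - (t / 2) *\<^sub>R e) * (c - (t / 2) *\<^sub>R e) + ((3 / 4) * t * t) *\<^sub>R e"
      by (simp add: algebra_simps scaleR_unit_mult scaleR_left_distrib[symmetric])
    also have "0 \<le> \<dots>"
      using assms by (intro add_nonneg_nonneg square_nonneg scaleR_nonneg_nonneg unit_nonneg) auto
    finally show ?thesis by simp
  qed
  then have "(1 / t) *\<^sub>R (t *\<^sub>R (c - t *\<^sub>R e)) \<le> (1 / t) *\<^sub>R (c * c)"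
    using assms by (intro scaleR_left_mono) auto
  then have "c - t *\<^sub>R e \<le> (1 / t) *\<^sub>R (c * c)" using assms by simp
  moreover have "0 \<le> (1 / t) *\<^sub>R (c * c)"
    using assms by (intro scaleR_nonneg_nonneg square_nonneg) auto
  ultimately show ?thesis unfolding pprt_def by simp
qed

text \<open>If \<open>y\<close> squares to zero, the arithmetic-geometric inequality for
  \<open>y\<close> and \<open>t *\<^sub>R e\<close> reads
  \<open>y \<le> (t / 2) *\<^sub>R e\<close>, for every positive \<open>t\<close>.\<close>

lemma semiprime:
  fixes x :: 'u
  assumes "x * x = 0"
  shows "x = 0"
proof -
  have *: "y \<le> 0" if "y * y = 0" for y :: 'u
  proof -
    have "y \<le> (t/2) *\<^sub>R e" if "0 < t" for t
    proof -
      have "2 *\<^sub>R (y * (t *\<^sub>R e)) \<le> y * y + (t *\<^sub>R e) * (t *\<^sub>R e)" by (rule two_mult_le)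
      then have "(2 * t) *\<^sub>R y \<le> (t * t) *\<^sub>R e"
        by (simp add: \<open>y * y = 0\<close> scaleR_unit_mult)
      then have "(1 / (2 * t)) *\<^sub>R ((2 * t) *\<^sub>R y) \<le> (1 / (2 * t)) *\<^sub>R ((t * t) *\<^sub>R e)"
        using that by (intro scaleR_left_mono) auto
      then show ?thesis using that by simp
    qed
    then have "y \<le> \<epsilon> *\<^sub>R e" if "0 < \<epsilon>" for \<epsilon> 
      using that by (metis mult_pos_pos nonzero_mult_div_cancel_left zero_less_numeral zero_neq_numeral)
    then show ?thesis by (rule archimedean_eps)
  qed
  from *[of x] *[of "- x"] assms show ?thesis by (intro order.antisym) auto
qed

text \<open>Multiplying \<open>(r - s) * (r + s) \<le> 0\<close> by \<open>?d\<close> gives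
  \<open>?d * ?d * (r + s) \<le> 0\<close>. Since \<open>?d \<le> r + s\<close>, the cube of
  \<open>?d\<close> vanishes, and there are no nonzero nilpotents. This yields uniqueness of square
  roots and reduces norm bounds to bounds on squares.\<close>

lemma square_le_imp_le:
  fixes r s :: 'u
  assumes "r * r \<le> s * s" "0 \<le> r" "0 \<le> s"
  shows "r \<le> s"
proof -
  let ?d = "pprt (r - s)"
  have "?d \<le> r" using assms unfolding pprt_def by simp
  have "?d * ((r - s) * (r + s)) \<le> ?d * 0"
    using assms by (intro mult_left_mono) (auto simp: algebra_simps mult.commute)
  then have "?d * ?d * (r + s) \<le> 0"
    by (metis mult.assoc mult_zero_right pprt_mult_self)
  moreover have "?d * ?d * ?d \<le> ?d * ?d * (r + s)"
    using \<open>?d \<le> r\<close> assms by (intro mult_left_mono square_nonneg) (simp add: add_increasing2)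
  moreover have "0 \<le> ?d * ?d * ?d" by (simp add: mult_nonneg_nonneg)
  ultimately have "?d * ?d * ?d = 0" by (meson order.antisym order_trans)
  then have "(?d * ?d) * (?d * ?d) = 0" by (metis mult.assoc mult_zero_left)
  then have "?d = 0" using semiprime by blast
  then show ?thesis by (simp add: le_zero_iff_zero_pprt[symmetric])
qed

text \<open>A scalar factor commutes with suprema. So \<open>c\<close> is split at level
  \<open>t\<close> into at most \<open>t *\<^sub>R e\<close> plus an excess; the excess contributes
  at most \<open>(1 / t) *\<^sub>R ?w\<close>, which disappears as \<open>t\<close> grows.\<close>

lemma mult_cSup:
  fixes S :: "'u set"
  assumes "S \<noteq> {}" "bdd_above S" "0 \<le> c" "\<And>s. s \<in> S \<Longrightarrow> c * s \<le> u"
  shows "c * Sup S \<le> u"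
proof -
  obtain s0 where s0: "s0 \<in> S" using assms by blast
  let ?m = "Sup S" and ?v = "c * Sup S - u"
  have le: "s \<le> ?m" if "s \<in> S" for s using that assms cSup_upper by blast
  let ?w = "c * c * (?m - s0)"
  have "?v \<le> (1 / t) *\<^sub>R ?w" if t: "0 < t" for t
  proof -
    let ?r = "pprt (c - t *\<^sub>R e) * (?m - s0)"
    \<comment> \<open>Passing from \<open>s\<close> to \<open>sup s s0\<close> bounds the distance
      to \<open>?m\<close> by the fixed \<open>?m - s0\<close>, so the contribution of the excess is
      the same \<open>?r\<close> for all \<open>s\<close>.\<close>
    have 1: "?v - ?r \<le> t *\<^sub>R (?m - sup s s0)" if "s \<in> S" for s
    proof -
      have "c * sup s s0 \<le> u"
        using assms(3,4) that s0 by (simp add: mult_sup_distrib_left)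
      then have "?v \<le> c * (?m - sup s s0)" by (simp only: right_diff_distrib diff_left_mono)
      also have "\<dots> \<le> (t *\<^sub>R e + pprt (c - t *\<^sub>R e)) * (?m - sup s s0)"
      proof (rule mult_right_mono)
        show "c \<le> t *\<^sub>R e + pprt (c - t *\<^sub>R e)"
          using sup_ge1[of "c - t *\<^sub>R e" 0] unfolding pprt_def[symmetric]
          by (simp only: diff_le_eq add.commute)
        show "0 \<le> ?m - sup s s0" using le that s0 by simp
      qed
      also have "\<dots> = t *\<^sub>R (?m - sup s s0) + pprt (c - t *\<^sub>R e) * (?m - sup s s0)"
        by (simp only: distrib_right scaleR_unit_mult)
      also have "pprt (c - t *\<^sub>R e) * (?m - sup s s0) \<le> ?r"
        by (rule mult_left_mono) (simp_all only: zero_le_pprt diff_left_mono sup_ge2)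
      finally show ?thesis by (simp add: diff_le_eq)
    qed
    have "s \<le> ?m - (1 / t) *\<^sub>R (?v - ?r)" if "s \<in> S" for s
    proof -
      have "(1 / t) *\<^sub>R (?v - ?r) \<le> (1 / t) *\<^sub>R (t *\<^sub>R (?m - sup s s0))"
        using 1[OF that] t by (intro scaleR_left_mono) auto
      also have "\<dots> = ?m - sup s s0" using t by simp
      also have "\<dots> \<le> ?m - s" by (simp only: diff_left_mono sup_ge1)
      finally show ?thesis by (simp add: le_diff_eq add.commute)
    qed
    then have "?m \<le> ?m - (1 / t) *\<^sub>R (?v - ?r)" using assms(1) by (intro cSup_least) auto
    then have "(1 / t) *\<^sub>R (?v - ?r) \<le> 0" by simp
    then have "t *\<^sub>R ((1 / t) *\<^sub>R (?v - ?r)) \<le> t *\<^sub>R 0" using t by (intro scaleR_left_mono) auto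
    then have "?v \<le> ?r" using t by simp
    also have "\<dots> \<le> ((1 / t) *\<^sub>R (c * c)) * (?m - s0)"
      using le[OF s0] by (intro mult_right_mono truncation_error t) auto
    finally show ?thesis by simp
  qed
  then have "?v \<le> \<epsilon> *\<^sub>R ?w" if "0 < \<epsilon>" for \<epsilon>
    using that by (metis divide_divide_eq_right div_by_1 mult_1 zero_less_divide_1_iff)
  then have "?v \<le> 0" by (rule archimedean_eps)
  then show ?thesis by simp
qed

text \<open>The quotient is the largest nonnegative \<open>z\<close> with
  \<open>?c * z \<le> y\<close>. If the remainder \<open>?w\<close> met the region where
  \<open>?c\<close> is below level \<open>t\<close>, this \<open>z\<close> could be enlarged there.
  Hence \<open>?t *\<^sub>R ?w \<le> ?w * ?c\<close> at every positive integer level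
  \<open>?t\<close>, which forces \<open>?w = 0\<close>.\<close>

lemma division:
  fixes a y :: 'u
  assumes "0 < \<epsilon>" "0 \<le> a" "0 \<le> y"
  shows "\<exists>z. 0 \<le> z \<and> a * z + \<epsilon> *\<^sub>R z = y"
proof -
  let ?c = "a + \<epsilon> *\<^sub>R e"
  have c: "0 \<le> ?c" "?c * z = a * z + \<epsilon> *\<^sub>R z" for z
    using assms unit_nonneg by (auto simp: distrib_right scaleR_unit_mult scaleR_nonneg_nonneg)
  let ?Z = "{z. 0 \<le> z \<and> ?c * z \<le> y}"
  have ne: "0 \<in> ?Z" using assms by simp
  have bd: "bdd_above ?Z"
  proof (rule bdd_aboveI)
    fix z assume "z \<in> ?Z"
    then have "\<epsilon> *\<^sub>R z \<le> y"
      using mult_nonneg_nonneg[OF assms(2), of z] c(2)[of z] 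
      by (metis (mono_tags, lifting) add_increasing mem_Collect_eq order.trans order_refl)
    then have "(1/\<epsilon>) *\<^sub>R (\<epsilon> *\<^sub>R z) \<le> (1/\<epsilon>) *\<^sub>R y" using assms by (intro scaleR_left_mono) auto
    then show "z \<le> (1/\<epsilon>) *\<^sub>R y" using assms by simp
  qed
  let ?s = "Sup ?Z"
  have s0: "0 \<le> ?s" using cSup_upper[OF ne bd] .
  have sy: "?c * ?s \<le> y" by (rule mult_cSup[OF _ bd c(1)]) (use ne in auto)
  let ?w = "y - ?c * ?s"
  have w: "0 \<le> ?w" using sy by simp
  have z: "?w * pprt (t *\<^sub>R e - ?c) = 0" if t: "0 < t" for t
  proof -
    let ?p = "pprt (t *\<^sub>R e - ?c)"
    \<comment> \<open>The factor is chosen so that \<open>?c * ?v \<le> ?w\<close>: the square of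
      \<open>?p\<close> is nonnegative, so \<open>?c * ?p \<le> t *\<^sub>R ?p\<close>, and
      \<open>?p \<le> t *\<^sub>R e\<close>.\<close>
    let ?v = "(1 / (t * t)) *\<^sub>R (?w * ?p)"
    have v0: "0 \<le> ?v" using w t by (intro scaleR_nonneg_nonneg mult_nonneg_nonneg) auto
    have p: "?p \<le> t *\<^sub>R e" using c(1) t unit_nonneg unfolding pprt_def
      by (auto simp only: sup.bounded_iff scaleR_nonneg_nonneg less_imp_le diff_le_eq le_add_same_cancel1)
    have cp: "?c * ?p \<le> (t * t) *\<^sub>R e"
    proof -
      have "?p * ?p = ?p * (t *\<^sub>R e - ?c)" by (simp only: pprt_mult_self)
      then have "?p * ?p = t *\<^sub>R ?p - ?c * ?p"
        by (simp only: right_diff_distrib scaleR_unit_mult mult.commute[of ?c])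
      moreover have "0 \<le> ?p * ?p" by (rule square_nonneg)
      ultimately have "?c * ?p \<le> t *\<^sub>R ?p" by simp
      also have "\<dots> \<le> t *\<^sub>R (t *\<^sub>R e)" using p t by (intro scaleR_left_mono) auto
      finally show ?thesis by simp
    qed
    have "?c * ?v = (1 / (t * t)) *\<^sub>R (?w * (?c * ?p))"
      by (simp add: mult.left_commute)
    also have "\<dots> \<le> (1 / (t * t)) *\<^sub>R (?w * ((t * t) *\<^sub>R e))"
      using cp w t by (intro scaleR_left_mono mult_left_mono) auto
    also have "\<dots> = ?w" using t by (simp only: scaleR_unit_mult) simp
    finally have "?c * (?s + ?v) \<le> y" by (simp only: distrib_left) (simp add: algebra_simps)
    then have "?s + ?v \<in> ?Z" using s0 v0 by simp
    then have "?s + ?v \<le> ?s" by (rule cSup_upper[OF _ bd])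
    then have "?v = 0" using v0 by (intro order.antisym) auto
    then show ?thesis using t by simp
  qed
  have "?w \<le> 0"
  proof (rule archimedean)
    fix n
    let ?t = "real (Suc n)"
    have "?w * (?t *\<^sub>R e - ?c) \<le> ?w * pprt (?t *\<^sub>R e - ?c)"
      using w by (intro mult_left_mono) (simp_all only: pprt_def sup_ge1)
    also have "\<dots> = 0" by (rule z) simp
    finally have "?w * (?t *\<^sub>R e) \<le> ?w * ?c"
      by (subst (asm) right_diff_distrib) (rule diff_le_0_iff_le[THEN iffD1])
    then show "?t *\<^sub>R ?w \<le> ?w * ?c" by (subst (asm) scaleR_unit_mult(2))
  qed
  then have "?c * ?s = y" using sy by (intro order.antisym) auto
  then show ?thesis using c(2) s0 by metis
qed

lemma mult_cInf:
  fixes S :: "'u set"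
  assumes "S \<noteq> {}" "bdd_below S" "0 \<le> c" "\<And>s. s \<in> S \<Longrightarrow> u \<le> c * s"
  shows "u \<le> c * Inf S"
proof -
  have b: "bdd_above (uminus ` S)"
  proof -
    obtain l where "\<And>s. s \<in> S \<Longrightarrow> l \<le> s" using assms(2) by (auto simp: bdd_below_def)
    then show ?thesis by (intro bdd_aboveI[of _ "- l"]) auto
  qed
  have "c * Sup (uminus ` S) \<le> - u"
    by (rule mult_cSup[OF _ b assms(3)]) (use assms(1,4) in auto)
  then have "u \<le> c * (- Sup (uminus ` S))" by (simp add: le_minus_iff)
  also have "\<dots> \<le> c * Inf S"
  proof (rule mult_left_mono[OF _ assms(3)])
    show "- Sup (uminus ` S) \<le> Inf S"
    proof (rule cInf_greatest[OF assms(1)])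
      fix s assume "s \<in> S"
      then have "- s \<le> Sup (uminus ` S)" by (intro cSup_upper[OF _ b]) auto
      then show "- Sup (uminus ` S) \<le> s" by (simp add: minus_le_iff)
    qed
  qed
  finally show ?thesis .
qed

section \<open>Existence of square roots\<close>

lemma square_diff_unit:
  "(x - p *\<^sub>R e) * (x - p *\<^sub>R e) = x * x + (p * p) *\<^sub>R e - (2 * p) *\<^sub>R x"
proof -
  have "(2 * p) *\<^sub>R x = p *\<^sub>R x + p *\<^sub>R x" by (simp only: mult_2 scaleR_left_distrib)
  then show ?thesis by (simp add: left_diff_distrib right_diff_distrib scaleR_diff_right)
qed

text \<open>With \<open>?m = inf a b\<close>, each square exceeds \<open>?m * ?m\<close> by
  \<open>(a + ?m) * ?x\<close> and \<open>(b + ?m) * ?y\<close>. These surpluses are disjoint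
  because \<open>?x\<close> and \<open>?y\<close> are.\<close>

lemma inf_square:
  fixes a b :: 'u
  assumes "0 \<le> a" "0 \<le> b"
  shows "inf a b * inf a b = inf (a * a) (b * b)"
proof -
  let ?m = "inf a b"
  let ?x = "a - ?m" and ?y = "b - ?m"
  have m: "0 \<le> ?m" "0 \<le> ?x" "0 \<le> ?y" using assms by auto
  have "inf ?x ?y = inf a b - ?m"
    by (simp only: diff_conv_add_uminus add_inf_distrib_right)
  then have d: "inf ?x ?y = 0" by simp
  have "inf ((a + ?m) * ?x) ((b + ?m) * ?y) = 0"
    using assms m by (intro inf_mult_mult_eq_zero d) (auto intro: add_nonneg_nonneg)
  moreover have "a * a = ?m * ?m + (a + ?m) * ?x" "b * b = ?m * ?m + (b + ?m) * ?y"
    by (simp_all add: algebra_simps)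
  ultimately show ?thesis by (metis add.right_neutral add_inf_distrib_left)
qed

text \<open>Marching along a grid of mesh \<open>d\<close>, the distance from \<open>r\<close> to the grid is at most \<open>d\<close>,
  except where \<open>r\<close> lies beyond the grid.\<close>

lemma grid_distance:
  fixes r w :: 'u
  assumes "0 \<le> r" "0 \<le> d"
    and w: "\<And>t. 0 \<le> t \<Longrightarrow> w \<le> (r - t *\<^sub>R e) * (r - t *\<^sub>R e)"
  shows "w \<le> sup (d *\<^sub>R e) (r - (real k * d) *\<^sub>R e) * sup (d *\<^sub>R e) (r - (real k * d) *\<^sub>R e)"
proof (induction k)
  case 0
  have "w \<le> r * r" using w[of 0] by simp
  also have "\<dots> \<le> sup (d *\<^sub>R e) r * sup (d *\<^sub>R e) r" using assms by (intro square_mono) auto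
  finally show ?case by simp
next
  case (Suc k)
  let ?s = "r - (real (Suc k) * d) *\<^sub>R e" and ?d = "d *\<^sub>R e"
  let ?p = "pprt ?s" and ?n = "pprt (- ?s)" and ?g = "r - (real k * d) *\<^sub>R e"
  have d0: "0 \<le> ?d" using assms unit_nonneg by (intro scaleR_nonneg_nonneg)
  have eq: "?d + ?s = ?g" by (simp add: algebra_simps)
  have "?d + ?p = sup (?d + ?s) ?d" unfolding pprt_def by (simp add: add_sup_distrib_left)
  then have g: "sup ?d ?g = ?d + ?p" unfolding eq by (simp only: sup_commute)
  have "0 \<le> real (Suc k) * d" using assms by simp
  then have "w \<le> sup ?s (- ?s) * sup ?s (- ?s)"
    unfolding square_sup_uminus by (rule w)
  then have "w \<le> inf (sup ?d ?g * sup ?d ?g) (sup ?s (- ?s) * sup ?s (- ?s))"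
    using Suc.IH by simp
  also have "\<dots> = inf (sup ?d ?g) (sup ?s (- ?s)) * inf (sup ?d ?g) (sup ?s (- ?s))"
    using d0 by (intro inf_square[symmetric] sup_uminus_nonneg) (auto intro: le_supI1)
  \<comment> \<open>The bounds coming from the earlier grid points and from the new one are
    \<open>?d + ?p\<close> and \<open>?p + ?n\<close>. Their infimum is \<open>?p\<close> beyond the
    new point and at most \<open>?d\<close> below it.\<close>
  also have "\<dots> \<le> sup ?d ?s * sup ?d ?s"
  proof (rule square_mono)
    show "0 \<le> inf (sup ?d ?g) (sup ?s (- ?s))"
      using d0 by (intro le_infI sup_uminus_nonneg le_supI1)
    have "inf (sup ?d ?g) (sup ?s (- ?s)) = ?p + inf ?d ?n"
      unfolding g sup_uminus_eq_pprts by (simp add: add_inf_distrib_left add.commute)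
    also have "\<dots> = sup ?p (inf ?d ?n)"
    proof -
      have "inf ?p (inf ?d ?n) = 0"
        using inf_pprts[of ?s] d0 by (simp add: inf.left_commute inf_absorb2)
      then show ?thesis using add_eq_inf_sup[of ?p "inf ?d ?n"] by simp
    qed
    also have "\<dots> \<le> sup ?d ?s"
      unfolding pprt_def using d0 by (auto intro: le_supI1 le_infI1)
    finally show "inf (sup ?d ?g) (sup ?s (- ?s)) \<le> sup ?d ?s" .
  qed
  finally show ?case .
qed

text \<open>This replaces the pointwise fact that the squared distance from a number to the
  nonnegative reals can be made zero. Grid points of mesh \<open>1 / m\<close> up to level
  \<open>m\<close> bound \<open>w\<close> by a fixed element divided by \<open>m\<close>.\<close>

lemma le_zero_if_le_squares:
  fixes r w :: 'u
  assumes r: "0 \<le> r" and w: "\<And>t. 0 \<le> t \<Longrightarrow> w \<le> (r - t *\<^sub>R e) * (r - t *\<^sub>R e)"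
  shows "w \<le> 0"
proof (rule archimedean)
  fix n
  let ?m = "real (Suc n)"
  let ?d = "(1 / ?m) *\<^sub>R e" and ?p = "pprt (r - ?m *\<^sub>R e)"
  \<comment> \<open>A grid of mesh \<open>1 / ?m\<close> needs \<open>Suc n * Suc n\<close> steps to
    reach level \<open>?m\<close>; mesh and overshoot then become small together.\<close>
  have m: "0 < ?m" "real (Suc n * Suc n) * (1 / ?m) = ?m"
    by (simp_all only: of_nat_mult) simp_all
  have d0: "0 \<le> ?d" using m unit_nonneg by (intro scaleR_nonneg_nonneg) simp_all
  have "w \<le> sup ?d (r - ?m *\<^sub>R e) * sup ?d (r - ?m *\<^sub>R e)"
    using grid_distance[OF r _ w, of "1 / ?m" "Suc n * Suc n"] m by simp
  also have "\<dots> \<le> (?d + ?p) * (?d + ?p)"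
  proof (rule square_mono)
    show "0 \<le> sup ?d (r - ?m *\<^sub>R e)" using d0 by (rule le_supI1)
    have "r - ?m *\<^sub>R e \<le> ?p" unfolding pprt_def by simp
    then show "sup ?d (r - ?m *\<^sub>R e) \<le> ?d + ?p"
      using d0 by (simp add: add_increasing)
  qed
  also have "\<dots> = ?d * ?d + ?p * ?p + 2 *\<^sub>R (?d * ?p)"
    by (simp only: distrib_left distrib_right scaleR_2 mult.commute[of ?p ?d] add_ac)
  also have "\<dots> \<le> 2 *\<^sub>R (?d * ?d + ?p * ?p)"
    using two_mult_le[of ?d ?p] by (simp only: scaleR_2 add_left_mono)
  also have "\<dots> \<le> 2 *\<^sub>R ((1 / ?m) *\<^sub>R e + (1 / ?m) *\<^sub>R (r * r * r))"
  proof (intro scaleR_left_mono add_mono)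
    have "?d * ?d = (1 / ?m) *\<^sub>R ((1 / ?m) *\<^sub>R e)" by simp
    also have "\<dots> \<le> (1 / ?m) *\<^sub>R (1 *\<^sub>R e)"
      using unit_nonneg by (intro scaleR_left_mono scaleR_right_mono) auto
    finally show "?d * ?d \<le> (1 / ?m) *\<^sub>R e" by simp
    have "?p \<le> r" unfolding pprt_def using r
      by (simp add: diff_le_eq scaleR_nonneg_nonneg unit_nonneg)
    then have "?p * ?p \<le> r * ?p" by (rule mult_right_mono) simp
    also have "\<dots> \<le> r * ((1 / ?m) *\<^sub>R (r * r))"
      by (intro mult_left_mono truncation_error r m)
    finally show "?p * ?p \<le> (1 / ?m) *\<^sub>R (r * r * r)" by (simp add: mult.assoc)
  qed auto
  also have "\<dots> = (1 / ?m) *\<^sub>R (2 *\<^sub>R (e + r * r * r))"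
    by (simp add: scaleR_add_right)
  finally have "?m *\<^sub>R w \<le> ?m *\<^sub>R ((1 / ?m) *\<^sub>R (2 *\<^sub>R (e + r * r * r)))"
    by (rule scaleR_left_mono) simp
  then show "?m *\<^sub>R w \<le> 2 *\<^sub>R (e + r * r * r)" by (simp del: of_nat_Suc)
qed

text \<open>The square root of \<open>b\<close> is an infimum of affine functions of \<open>b\<close>, by the inequality of
  arithmetic and geometric means.\<close>

lemma square_root:
  fixes b :: 'u
  assumes b: "0 \<le> b"
  defines "q \<equiv> \<lambda>t. (1 / 2) *\<^sub>R ((1 / t) *\<^sub>R b + t *\<^sub>R e)"
  defines "r \<equiv> Inf (q ` {0<..})"
  shows "bdd_below (q ` {0<..})" and "0 \<le> r" and "r * r = b"
proof -
  have q0: "0 \<le> q t" if "0 < t" for t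
    using that b unit_nonneg unfolding q_def
    by (intro scaleR_nonneg_nonneg add_nonneg_nonneg) auto
  show bd: "bdd_below (q ` {0<..})" using q0 by (intro bdd_belowI[of _ 0]) auto
  have ne: "q ` {0<..} \<noteq> {}" by auto
  show r0: "0 \<le> r" unfolding r_def using q0 by (intro cInf_greatest ne) auto
  have rq: "r \<le> q t" if "0 < t" for t
    unfolding r_def using that by (intro cInf_lower bd) auto
  have sq: "2 *\<^sub>R x \<le> (1 / p) *\<^sub>R (x * x) + p *\<^sub>R e" if "0 < p" for p and x :: 'u
  proof -
    have "0 \<le> (1 / p) *\<^sub>R ((x - p *\<^sub>R e) * (x - p *\<^sub>R e))"
      using that by (intro scaleR_nonneg_nonneg square_nonneg) auto
    also note square_diff_unit
    finally show ?thesis using that by (simp add: scaleR_add_right scaleR_diff_right)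
  qed
  \<comment> \<open>Two independent parameters are needed since the infimum is taken in one factor
    of \<open>r * r\<close> at a time. The inequality uses \<open>2 *\<^sub>R b \<le> (1 / p)
    *\<^sub>R (b * b) + p *\<^sub>R e\<close> at \<open>p = s * t\<close>, together with
    \<open>2 \<le> t / s + s / t\<close>.\<close>
  have qq: "b \<le> q s * q t" if "0 < s" "0 < t" for s t
  proof -
    have "q s * q t = (1 / 4) *\<^sub>R (((1 / (s * t)) *\<^sub>R (b * b) + (s * t) *\<^sub>R e) + (t / s + s / t) *\<^sub>R b)"
    proof -
      have "((1 / s) *\<^sub>R b + s *\<^sub>R e) * ((1 / t) *\<^sub>R b + t *\<^sub>R e) =
          ((1 / (s * t)) *\<^sub>R (b * b) + (t / s) *\<^sub>R b) + ((s / t) *\<^sub>R b + (s * t) *\<^sub>R e)"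
        by (simp add: distrib_right distrib_left scaleR_add_right mult.commute[of t s])
      also have "\<dots> = ((1 / (s * t)) *\<^sub>R (b * b) + (s * t) *\<^sub>R e) + (t / s + s / t) *\<^sub>R b"
        by (simp only: scaleR_left_distrib add_ac mult.commute)
      finally show ?thesis unfolding q_def by simp
    qed
    moreover have "2 *\<^sub>R b + 2 *\<^sub>R b \<le> ((1 / (s * t)) *\<^sub>R (b * b) + (s * t) *\<^sub>R e) + (t / s + s / t) *\<^sub>R b"
    proof (intro add_mono sq scaleR_right_mono b)
      have "0 \<le> (s - t) * (s - t)" by simp
      then have "2 * (s * t) \<le> t * t + s * s" by (simp add: algebra_simps)
      then show "2 \<le> t / s + s / t" using that by (simp add: field_simps)
    qed (use that in simp)
    then have "(1 / 4) *\<^sub>R (2 *\<^sub>R b + 2 *\<^sub>R b) \<le>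
        (1 / 4) *\<^sub>R (((1 / (s * t)) *\<^sub>R (b * b) + (s * t) *\<^sub>R e) + (t / s + s / t) *\<^sub>R b)"
      by (rule scaleR_left_mono) simp
    ultimately show ?thesis by (simp add: scaleR_left_distrib[symmetric])
  qed
  have "b \<le> r * q s" if "0 < s" for s
    using mult_cInf[OF ne bd q0[OF that], of b] qq that
    unfolding r_def by (auto simp: mult.commute)
  then have "b \<le> r * r"
    using mult_cInf[OF ne bd r0, of b] unfolding r_def by auto
  \<comment> \<open>For positive \<open>t\<close>, the bound \<open>r \<le> q t\<close> multiplied
    by \<open>2 * t\<close> is exactly
    \<open>r * r - b \<le> (r - t *\<^sub>R e) * (r - t *\<^sub>R e)\<close>; at
    \<open>t = 0\<close> it is the sign of \<open>b\<close>.\<close>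
  moreover have "r * r - b \<le> 0"
  proof (rule le_zero_if_le_squares[OF r0])
    fix t :: real assume t: "0 \<le> t"
    show "r * r - b \<le> (r - t *\<^sub>R e) * (r - t *\<^sub>R e)"
    proof (cases "t = 0")
      case True
      then show ?thesis using b by simp
    next
      case False
      then have "(2 * t) *\<^sub>R r \<le> (2 * t) *\<^sub>R q t" using t rq by (intro scaleR_left_mono) auto
      also have "\<dots> = b + (t * t) *\<^sub>R e"
        unfolding q_def using False by (simp add: scaleR_add_right)
      finally show ?thesis
        unfolding square_diff_unit by (simp add: algebra_simps)
    qed
  qed
  ultimately show "r * r = b" by (intro order.antisym) auto
qed

end

section \<open>The extended conditional expectation\<close>

lemma directed_on_nonempty: "directed_on le I \<Longrightarrow> I \<noteq> {}"
  by (simp add: directed_on_def)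

lemma directed_onD: "directed_on le I \<Longrightarrow> i \<in> I \<Longrightarrow> j \<in> I \<Longrightarrow> \<exists>k\<in>I. le i k \<and> le j k"
  unfolding directed_on_def by blast

context riesz_conditional_expectation
begin

sublocale unital_f_algebra e
  by unfold_locales (rule mult_unit)

lemma E_zero: "0 \<in> E"
  and E_add: "x \<in> E \<Longrightarrow> y \<in> E \<Longrightarrow> x + y \<in> E"
  and E_diff: "x \<in> E \<Longrightarrow> y \<in> E \<Longrightarrow> x - y \<in> E"
  and E_scaleR: "x \<in> E \<Longrightarrow> c *\<^sub>R x \<in> E"
  and E_sup: "x \<in> E \<Longrightarrow> y \<in> E \<Longrightarrow> sup x y \<in> E"
  and E_inf: "x \<in> E \<Longrightarrow> y \<in> E \<Longrightarrow> inf x y \<in> E"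
  using universal_completion
  by (simp_all add: universal_completion_of_def riesz_subspace_def subspace_0 subspace_add
      subspace_diff subspace_scale)

lemma order_dense: "0 < u \<Longrightarrow> \<exists>x\<in>E. 0 < x \<and> x \<le> u"
  using universal_completion by (simp add: universal_completion_of_def)

lemma e_in_E: "e \<in> E"
  using weak_unit by (simp add: weak_order_unit_def)

lemma T_zero: "T 0 = 0"
  using scale[OF E_zero, of 0] by simp

lemma T_diff: "x \<in> E \<Longrightarrow> y \<in> E \<Longrightarrow> T (x - y) = T x - T y"
  using add[of "x - y" y] E_diff by simp

lemma T_mono: "x \<in> E \<Longrightarrow> y \<in> E \<Longrightarrow> x \<le> y \<Longrightarrow> T x \<le> T y"
  using positive[of "y - x"] T_diff[of y x] E_diff by simp

text \<open>Order continuity speaks of infima in \<open>E\<close>, while the nets defining the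
  extension converge in the universal completion. The remainders \<open>x - inf x d\<close> connect
  the two, since they decrease to zero in \<open>E\<close>. The result makes the extension
  independent of the net chosen.\<close>

lemma T_le_of_net:
  assumes D: "D \<subseteq> E" "directed_on (\<le>) D" "is_sup_on (\<le>) UNIV D f"
    and x: "x \<in> E" "x \<le> f" and u: "\<And>d. d \<in> D \<Longrightarrow> T d \<le> u"
  shows "T x \<le> u"
proof -
  let ?D = "(\<lambda>d. x - inf x d) ` D"
  have DE: "?D \<subseteq> E" using D x by (auto intro!: E_diff E_inf)
  have "directed_on (\<ge>) ?D"
    unfolding directed_on_def
  proof (intro conjI ballI impI)
    show "?D \<noteq> {}" using D directed_on_nonempty by blast
    fix a b assume "a \<in> ?D" "b \<in> ?D"
    then obtain c d where cd: "c \<in> D" "d \<in> D" "a = x - inf x c" "b = x - inf x d" by blast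
    then obtain k where k: "k \<in> D" "c \<le> k" "d \<le> k" using directed_onD[OF D(2)] by blast
    then have "x - inf x k \<le> a" "x - inf x k \<le> b"
      unfolding cd by (simp_all add: le_infI2)
    then show "\<exists>z\<in>?D. a \<ge> z \<and> b \<ge> z" using k by blast
  qed auto
  moreover have "is_inf_on (\<le>) E ?D 0"
    unfolding is_inf_on_def
  proof (intro conjI ballI impI)
    fix l assume l: "\<forall>d\<in>?D. l \<le> d"
    \<comment> \<open>\<open>d\<close> is \<open>sup x d\<close> minus its remainder, so a lower
      bound \<open>l\<close> of the remainders makes \<open>f - l\<close> an upper bound of
      \<open>D\<close>.\<close>
    have "d \<le> f - l" if "d \<in> D" for d
    proof -
      have "d \<le> f" using D(3) that by (auto simp: is_sup_on_def)
      then have "sup x d \<le> f" using x by simp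
      have "l \<le> x - inf x d" using l that by blast
      have "d + x = sup x d + inf x d" using add_eq_inf_sup[of x d] by (simp add: add.commute)
      then have "sup x d = d + x - inf x d" by (simp add: eq_diff_eq)
      then have "d = sup x d - (x - inf x d)" by simp
      also have "\<dots> \<le> f - l" using \<open>sup x d \<le> f\<close> \<open>l \<le> _\<close> by (rule diff_mono)
      finally show ?thesis .
    qed
    then have "f \<le> f - l" using D(3) by (auto simp: is_sup_on_def)
    then show "l \<le> 0" by simp
  qed (auto simp: E_zero)
  ultimately have inf0: "is_inf_on (\<le>) E (T ` ?D) 0" by (rule order_continuous[OF DE])
  \<comment> \<open>As \<open>u\<close> need not lie in \<open>E\<close>, this lower bound need not
    either. If it were nonzero, order density would put a nonzero element of \<open>E\<close> below
    it, against the infimum in \<open>E\<close>.\<close>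
  let ?l = "pprt (T x - u)"
  have low: "?l \<le> T d" if "d \<in> ?D" for d
  proof -
    from that obtain c where c: "c \<in> D" "d = x - inf x c" by blast
    have cE: "c \<in> E" "inf x c \<in> E" using c D x E_inf by auto
    have "T (inf x c) \<le> T c" using T_mono cE by simp
    also have "\<dots> \<le> u" using u c by simp
    finally have "T x - u \<le> T d" using c T_diff x cE by simp
    moreover have "0 \<le> T d" using c cE x E_diff positive by simp
    ultimately show ?thesis unfolding pprt_def by simp
  qed
  have "?l = 0"
  proof (rule ccontr)
    assume "?l \<noteq> 0"
    then have "0 < ?l" by (simp add: less_le)
    then obtain z where z: "z \<in> E" "0 < z" "z \<le> ?l" using order_dense by blast
    then have "\<forall>d\<in>T ` ?D. z \<le> d" using low order_trans by blast
    then have "z \<le> 0" using inf0 z by (auto simp: is_inf_on_def)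
    then show False using z by simp
  qed
  then show ?thesis by (simp add: le_zero_iff_zero_pprt[symmetric])
qed

text \<open>The canonical choice of net: it contains every approximating net of \<open>f\<close>, so
  membership in the cone and the extended value can be tested on it alone.\<close>

definition cut :: "'u \<Rightarrow> 'u set" where
  "cut f = {x \<in> E. 0 \<le> x \<and> x \<le> f}"

lemma cut_directed:
  assumes "0 \<le> f"
  shows "directed_on (\<le>) (cut f)"
  unfolding directed_on_def
proof (intro conjI ballI impI)
  show "cut f \<noteq> {}" using assms E_zero by (auto simp: cut_def)
  show "\<exists>k\<in>cut f. x \<le> k \<and> y \<le> k" if "x \<in> cut f" "y \<in> cut f" for x y
    using that by (intro bexI[of _ "sup x y"]) (auto simp: cut_def E_sup le_supI1)
qed auto

text \<open>If the supremum \<open>?s\<close> were not \<open>f\<close>, order density would give a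
  nonzero \<open>x\<close> in \<open>E\<close> below \<open>f - ?s\<close>. Adding it to any member
  of the cut stays in the cut, so \<open>?s \<le> ?s - x\<close>.\<close>

lemma cut_sup:
  assumes "0 \<le> f"
  shows "is_sup_on (\<le>) UNIV (cut f) f"
  unfolding is_sup_on_def
proof (intro conjI ballI impI)
  fix u assume u: "\<forall>d\<in>cut f. d \<le> u"
  have bd: "bdd_above (cut f)" by (rule bdd_aboveI[of _ f]) (simp add: cut_def)
  have ne: "cut f \<noteq> {}" using cut_directed[OF assms] by (rule directed_on_nonempty)
  let ?s = "Sup (cut f)"
  have sf: "?s \<le> f" by (rule cSup_least[OF ne]) (simp add: cut_def)
  have "f = ?s"
  proof (rule ccontr)
    assume "f \<noteq> ?s"
    then have "0 < f - ?s" using sf by (simp add: less_le)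
    then obtain x where x: "x \<in> E" "0 < x" "x \<le> f - ?s" using order_dense by blast
    have "y \<le> ?s - x" if y: "y \<in> cut f" for y
    proof -
      have "y + x \<le> ?s + (f - ?s)" using cSup_upper[OF y bd] x by (intro add_mono)
      then have "y + x \<in> cut f" using y x by (simp add: cut_def E_add)
      then have "y + x \<le> ?s" by (rule cSup_upper[OF _ bd])
      then show ?thesis by (simp add: le_diff_eq)
    qed
    then have "?s \<le> ?s - x" by (rule cSup_least[OF ne])
    then show False using x by simp
  qed
  also have "?s \<le> u" using u by (intro cSup_least[OF ne]) auto
  finally show "f \<le> u" .
qed (auto simp: cut_def)

section \<open>The natural cone and the extension of T to it\<close>

abbreviation "K \<equiv> natural_cone E T"
abbreviation "\<kappa> \<equiv> cone_extension E T"
abbreviation "\<tau> \<equiv> extended E T"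

text \<open>Each of two nets for \<open>f\<close> bounds the images of the other by
  \<open>T_le_of_net\<close>, so the description defining \<open>\<kappa> f\<close> has exactly one
  solution.\<close>

lemma approximating_net_sup:
  assumes "approximating_net E T f D"
  shows "is_sup_on (\<le>) UNIV (T ` D) (\<kappa> f)"
proof -
  have D: "D \<subseteq> E" "directed_on (\<le>) D" "is_sup_on (\<le>) UNIV D f" "bdd_above (T ` D)"
    using assms by (auto simp: approximating_net_def)
  have ne: "T ` D \<noteq> {}" using D directed_on_nonempty by blast
  have "is_sup_on (\<le>) UNIV (T ` D) (Sup (T ` D))"
    unfolding is_sup_on_def using D(4) ne by (auto intro: cSup_upper cSup_least)
  moreover have "y' = y"
    if "approximating_net E T f D'" "is_sup_on (\<le>) UNIV (T ` D') y'"
      "approximating_net E T f D''" "is_sup_on (\<le>) UNIV (T ` D'') y" for D' D'' y y'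
  proof -
    have *: "y1 \<le> y2"
      if a: "approximating_net E T f D1" "is_sup_on (\<le>) UNIV (T ` D1) y1"
        "approximating_net E T f D2" "is_sup_on (\<le>) UNIV (T ` D2) y2" for D1 D2 y1 y2
    proof -
      have "T d \<le> y2" if "d \<in> D1" for d
      proof (rule T_le_of_net)
        show "D2 \<subseteq> E" "directed_on (\<le>) D2" "is_sup_on (\<le>) UNIV D2 f"
          using a by (auto simp: approximating_net_def)
        show "d \<in> E" "d \<le> f" using a that by (auto simp: approximating_net_def is_sup_on_def)
        show "T d \<le> y2" if "d \<in> D2" for d using a that by (auto simp: is_sup_on_def)
      qed
      then show ?thesis using a(2) by (auto simp: is_sup_on_def)
    qed
    show ?thesis using *[OF that] *[OF that(3,4) that(1,2)] by (rule order.antisym)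
  qed
  ultimately have "\<kappa> f = Sup (T ` D)"
    unfolding cone_extension_def using assms by (intro the_equality) blast+
  with \<open>is_sup_on (\<le>) UNIV (T ` D) (Sup (T ` D))\<close> show ?thesis by simp
qed

lemma cut_approximating_net:
  assumes "0 \<le> f" "bdd_above (T ` cut f)"
  shows "approximating_net E T f (cut f)"
  unfolding approximating_net_def
  using assms cut_directed cut_sup by (auto simp: cut_def)

lemma natural_cone_iff: "f \<in> K \<longleftrightarrow> 0 \<le> f \<and> bdd_above (T ` cut f)"
proof
  assume "f \<in> K"
  then obtain D where f: "0 \<le> f" "approximating_net E T f D" by (auto simp: natural_cone_def)
  then obtain u where u: "\<And>d. d \<in> D \<Longrightarrow> T d \<le> u"
    by (auto simp: approximating_net_def bdd_above_def)
  have "T x \<le> u" if "x \<in> cut f" for x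
    by (rule T_le_of_net[of D f]) (use f u that in \<open>auto simp: approximating_net_def cut_def\<close>)
  then show "0 \<le> f \<and> bdd_above (T ` cut f)" using f by (auto intro!: bdd_aboveI2[of _ _ u])
next
  assume "0 \<le> f \<and> bdd_above (T ` cut f)"
  then show "f \<in> K" using cut_approximating_net by (auto simp: natural_cone_def)
qed

lemma cone_nonneg: "f \<in> K \<Longrightarrow> 0 \<le> f"
  by (simp add: natural_cone_def)

lemma cone_extension_upper: "f \<in> K \<Longrightarrow> x \<in> cut f \<Longrightarrow> T x \<le> \<kappa> f"
  using approximating_net_sup[OF cut_approximating_net] natural_cone_iff
  by (auto simp: is_sup_on_def)

lemma cone_extension_least: "f \<in> K \<Longrightarrow> (\<And>x. x \<in> cut f \<Longrightarrow> T x \<le> u) \<Longrightarrow> \<kappa> f \<le> u"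
  using approximating_net_sup[OF cut_approximating_net] natural_cone_iff
  by (auto simp: is_sup_on_def)

lemma cone_mono:
  assumes "f \<in> K" "0 \<le> g" "g \<le> f"
  shows "g \<in> K" "\<kappa> g \<le> \<kappa> f"
proof -
  have sub: "cut g \<subseteq> cut f" using assms by (auto simp: cut_def)
  then show "g \<in> K" using assms unfolding natural_cone_iff by (meson bdd_above_mono image_mono)
  then show "\<kappa> g \<le> \<kappa> f" using sub assms cone_extension_upper by (blast intro: cone_extension_least)
qed

lemma cone_extension_nonneg: "f \<in> K \<Longrightarrow> 0 \<le> \<kappa> f"
  using cone_extension_upper[of f 0] T_zero cone_nonneg by (simp add: cut_def E_zero)

lemma cone_extension_strict:
  assumes "f \<in> K" "\<kappa> f = 0"
  shows "f = 0"
proof -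
  have "x \<le> 0" if "x \<in> cut f" for x
  proof -
    have x: "x \<in> E" "0 \<le> x" using that by (auto simp: cut_def)
    have "T x \<le> 0" using cone_extension_upper[OF assms(1) that] assms(2) by simp
    then have "T x = 0" using positive[OF x] by (rule order.antisym)
    then show ?thesis using strictly_positive[OF x] by simp
  qed
  then have "\<forall>x\<in>cut f. x \<le> 0" by blast
  then have "f \<le> 0"
    using cut_sup[OF cone_nonneg[OF assms(1)]] unfolding is_sup_on_def by blast
  then show ?thesis using cone_nonneg assms by (intro order.antisym) auto
qed

text \<open>Sums from the two cuts need not exhaust the cut of \<open>f + g\<close>, but they form
  an approximating net for it, and any such net computes the extension.\<close>

lemma cone_extension_add:
  assumes f: "f \<in> K" and g: "g \<in> K"
  shows "f + g \<in> K" "\<kappa> (f + g) = \<kappa> f + \<kappa> g"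
proof -
  let ?D = "{x + y | x y. x \<in> cut f \<and> y \<in> cut g}"
  have f0: "0 \<le> f" and g0: "0 \<le> g" using f g cone_nonneg by auto
  have dir: "directed_on (\<le>) ?D"
    unfolding directed_on_def
  proof (intro conjI ballI impI)
    show "?D \<noteq> {}" using f0 g0 E_zero by (auto simp: cut_def)
    fix a b assume "a \<in> ?D" "b \<in> ?D"
    then obtain x y x' y' where *: "a = x + y" "b = x' + y'" "x \<in> cut f" "y \<in> cut g"
      "x' \<in> cut f" "y' \<in> cut g" by auto
    then have "sup x x' \<in> cut f" "sup y y' \<in> cut g" by (auto simp: cut_def E_sup le_supI1)
    moreover have "a \<le> sup x x' + sup y y'" "b \<le> sup x x' + sup y y'"
      unfolding * by (simp_all add: add_mono)
    ultimately show "\<exists>k\<in>?D. a \<le> k \<and> b \<le> k" by blast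
  qed auto
  have sup: "is_sup_on (\<le>) UNIV ?D (f + g)"
    unfolding is_sup_on_def
  proof (intro conjI ballI impI)
    fix u assume u: "\<forall>d\<in>?D. d \<le> u"
    have "f \<le> u - y" if "y \<in> cut g" for y
    proof -
      have "x \<le> u - y" if "x \<in> cut f" for x
        using u that \<open>y \<in> cut g\<close> by (auto simp: le_diff_eq)
      then show ?thesis using cut_sup[OF f0] by (auto simp: is_sup_on_def)
    qed
    then have "f + y \<le> u" if "y \<in> cut g" for y
      using that by (simp add: le_diff_eq)
    then have "y \<le> u - f" if "y \<in> cut g" for y
      using that by (simp add: le_diff_eq add.commute[of y])
    then have "g \<le> u - f" using cut_sup[OF g0] by (auto simp: is_sup_on_def)
    then show "f + g \<le> u" by (simp add: le_diff_eq add.commute)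
  qed (auto simp: cut_def intro: add_mono)
  have T: "T (x + y) = T x + T y" if "x \<in> cut f" "y \<in> cut g" for x y
    using that add by (simp add: cut_def)
  have up: "T d \<le> \<kappa> f + \<kappa> g" if "d \<in> ?D" for d
    using that T f g by (auto intro!: add_mono cone_extension_upper)
  have net: "approximating_net E T (f + g) ?D"
    unfolding approximating_net_def
    using dir sup up by (auto simp: cut_def intro!: E_add bdd_aboveI[of _ "\<kappa> f + \<kappa> g"])
  then show "f + g \<in> K" using f0 g0 by (auto simp: natural_cone_def)
  have s: "is_sup_on (\<le>) UNIV (T ` ?D) (\<kappa> (f + g))" by (rule approximating_net_sup[OF net])
  show "\<kappa> (f + g) = \<kappa> f + \<kappa> g"
  proof (rule order.antisym)
    show "\<kappa> (f + g) \<le> \<kappa> f + \<kappa> g" using s up by (auto simp: is_sup_on_def)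
    have *: "T x + T y \<le> \<kappa> (f + g)" if "x \<in> cut f" "y \<in> cut g" for x y
    proof -
      have "T (x + y) \<in> T ` ?D" using that by blast
      then have "T (x + y) \<le> \<kappa> (f + g)" using s unfolding is_sup_on_def by blast
      then show ?thesis using T[OF that] by simp
    qed
    have "\<kappa> f \<le> \<kappa> (f + g) - T y" if "y \<in> cut g" for y
      by (rule cone_extension_least[OF f]) (use * that in \<open>simp add: le_diff_eq\<close>)
    then have "\<kappa> g \<le> \<kappa> (f + g) - \<kappa> f"
      by (intro cone_extension_least[OF g]) (simp add: le_diff_eq add.commute)
    then show "\<kappa> f + \<kappa> g \<le> \<kappa> (f + g)" by (simp add: le_diff_eq add.commute)
  qed
qed

lemma cone_extension_scaleR_le:
  assumes f: "f \<in> K" and c: "0 < c"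
  shows "c *\<^sub>R f \<in> K" "\<kappa> (c *\<^sub>R f) \<le> c *\<^sub>R \<kappa> f"
proof -
  have T: "T x \<le> c *\<^sub>R \<kappa> f" if "x \<in> cut (c *\<^sub>R f)" for x
  proof -
    have "(1 / c) *\<^sub>R x \<le> (1 / c) *\<^sub>R (c *\<^sub>R f)"
      using that c by (intro scaleR_left_mono) (auto simp: cut_def)
    then have "(1 / c) *\<^sub>R x \<in> cut f"
      using that c by (auto simp: cut_def E_scaleR intro: scaleR_nonneg_nonneg)
    then have "c *\<^sub>R T ((1 / c) *\<^sub>R x) \<le> c *\<^sub>R \<kappa> f"
      using c f by (intro scaleR_left_mono cone_extension_upper) auto
    then show ?thesis using scale[of x "1 / c"] that c by (simp add: cut_def)
  qed
  show "c *\<^sub>R f \<in> K"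
    unfolding natural_cone_iff using T c cone_nonneg[OF f]
    by (auto intro!: bdd_aboveI[of _ "c *\<^sub>R \<kappa> f"] scaleR_nonneg_nonneg)
  then show "\<kappa> (c *\<^sub>R f) \<le> c *\<^sub>R \<kappa> f" using T by (rule cone_extension_least)
qed

lemma zero_in_cone: "0 \<in> K" and cone_extension_zero: "\<kappa> 0 = 0"
proof -
  have c: "cut 0 = {0}" using E_zero by (auto simp: cut_def)
  then show "0 \<in> K" by (simp add: natural_cone_iff)
  then have "\<kappa> 0 \<le> 0" by (rule cone_extension_least) (simp add: c T_zero)
  then show "\<kappa> 0 = 0" using cone_extension_nonneg[OF \<open>0 \<in> K\<close>] by (intro order.antisym) auto
qed

text \<open>The one-sided estimate for \<open>c\<close> and the one for \<open>1 / c\<close> give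
  equality.\<close>

lemma cone_extension_scaleR:
  assumes f: "f \<in> K" and c: "0 \<le> c"
  shows "c *\<^sub>R f \<in> K" "\<kappa> (c *\<^sub>R f) = c *\<^sub>R \<kappa> f"
proof -
  consider "c = 0" | "0 < c" using c by fastforce
  then have "c *\<^sub>R f \<in> K \<and> \<kappa> (c *\<^sub>R f) = c *\<^sub>R \<kappa> f"
  proof cases
    case 1
    then show ?thesis by (simp add: zero_in_cone cone_extension_zero)
  next
    case 2
    have k: "c *\<^sub>R f \<in> K" using cone_extension_scaleR_le f 2 by blast
    have "\<kappa> ((1 / c) *\<^sub>R (c *\<^sub>R f)) \<le> (1 / c) *\<^sub>R \<kappa> (c *\<^sub>R f)"
      using 2 by (intro cone_extension_scaleR_le(2) k) simp
    then have "c *\<^sub>R \<kappa> f \<le> c *\<^sub>R ((1 / c) *\<^sub>R \<kappa> (c *\<^sub>R f))"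
      using 2 by (intro scaleR_left_mono) auto
    then have "c *\<^sub>R \<kappa> f \<le> \<kappa> (c *\<^sub>R f)" using 2 by simp
    then show ?thesis using k cone_extension_scaleR_le[OF f 2] by (auto intro: order.antisym)
  qed
  then show "c *\<^sub>R f \<in> K" "\<kappa> (c *\<^sub>R f) = c *\<^sub>R \<kappa> f" by auto
qed

text \<open>The images \<open>T\<close> followed by a cut of \<open>f\<close> form an approximating
  net for \<open>\<kappa> f\<close>, and \<open>T\<close> fixes each of them.\<close>

lemma cone_extension_idem:
  assumes f: "f \<in> K"
  shows "\<kappa> f \<in> K" "\<kappa> (\<kappa> f) = \<kappa> f"
proof -
  have net: "approximating_net E T f (cut f)"
    using f by (auto simp: natural_cone_iff intro: cut_approximating_net)
  have sub: "cut f \<subseteq> E" by (auto simp: cut_def)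
  have TT: "T ` T ` cut f = T ` cut f"
    unfolding image_image using sub projection by (intro image_cong) auto
  have "directed_on (\<le>) (T ` cut f)"
    unfolding directed_on_def
  proof (intro conjI ballI impI)
    show "T ` cut f \<noteq> {}" using directed_on_nonempty[OF cut_directed[OF cone_nonneg[OF f]]] by simp
    fix a b assume "a \<in> T ` cut f" "b \<in> T ` cut f"
    then obtain x y where xy: "a = T x" "b = T y" "x \<in> cut f" "y \<in> cut f" by blast
    then obtain z where "z \<in> cut f" "x \<le> z" "y \<le> z"
      using directed_onD[OF cut_directed[OF cone_nonneg[OF f]]] by blast
    then show "\<exists>k\<in>T ` cut f. a \<le> k \<and> b \<le> k"
      using xy sub by (intro bexI[of _ "T z"]) (auto intro!: T_mono)
  qed auto
  then have n: "approximating_net E T (\<kappa> f) (T ` cut f)"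
    unfolding approximating_net_def TT
    using net approximating_net_sup[OF net]
    by (auto simp: approximating_net_def cut_def maps_to positive)
  then show "\<kappa> f \<in> K" using cone_extension_nonneg[OF f] by (auto simp: natural_cone_def)
  have s: "is_sup_on (\<le>) UNIV (T ` cut f) (\<kappa> (\<kappa> f))"
    using approximating_net_sup[OF n] by (simp only: TT)
  show "\<kappa> (\<kappa> f) = \<kappa> f"
    using s approximating_net_sup[OF net] by (auto simp: is_sup_on_def intro!: order.antisym)
qed

lemma unit_in_cone: "e \<in> K" and cone_extension_unit: "\<kappa> e = e"
proof -
  have T: "T x \<le> e" if "x \<in> cut e" for x
    using that T_mono[of x e] fixes_unit e_in_E by (simp add: cut_def)
  show k: "e \<in> K" unfolding natural_cone_iff using T unit_nonneg by (auto intro!: bdd_aboveI2[of _ _ e])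
  show "\<kappa> e = e"
  proof (rule order.antisym)
    show "\<kappa> e \<le> e" using k T by (rule cone_extension_least)
    show "e \<le> \<kappa> e"
      using cone_extension_upper[OF k, of e] fixes_unit e_in_E unit_nonneg by (simp add: cut_def)
  qed
qed

text \<open>Two representations of the same difference satisfy \<open>f1 + g2 = g1 + f2\<close>;
  additivity on the cone shows that they give the same value.\<close>

lemma extended_diff:
  assumes "f1 \<in> K" "f2 \<in> K"
  shows "\<tau> (f1 - f2) = \<kappa> f1 - \<kappa> f2"
  unfolding extended_def
proof (rule the_equality)
  show "\<exists>g1 g2. g1 \<in> K \<and> g2 \<in> K \<and> f1 - f2 = g1 - g2 \<and> \<kappa> f1 - \<kappa> f2 = \<kappa> g1 - \<kappa> g2"
    using assms by blast
  fix y assume "\<exists>g1 g2. g1 \<in> K \<and> g2 \<in> K \<and> f1 - f2 = g1 - g2 \<and> y = \<kappa> g1 - \<kappa> g2"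
  then obtain g1 g2 where g: "g1 \<in> K" "g2 \<in> K" "f1 - f2 = g1 - g2" "y = \<kappa> g1 - \<kappa> g2" by blast
  then have "f1 + g2 = g1 + f2" by (simp add: diff_eq_eq algebra_simps)
  then have "\<kappa> f1 + \<kappa> g2 = \<kappa> g1 + \<kappa> f2" using cone_extension_add assms g by metis
  then have "\<kappa> g1 + \<kappa> f2 - (\<kappa> g2 + \<kappa> f2) = \<kappa> f1 + \<kappa> g2 - (\<kappa> g2 + \<kappa> f2)" by simp
  then show "y = \<kappa> f1 - \<kappa> f2" using g by simp
qed

lemma extended_cone: "f \<in> K \<Longrightarrow> \<tau> f = \<kappa> f"
  using extended_diff[of f 0] zero_in_cone cone_extension_zero by simp

section \<open>The natural domain as an order ideal with strictly positive T\<close>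

abbreviation "\<L>\<^sub>1 \<equiv> L1 E T"

lemma L1I: "f \<in> K \<Longrightarrow> g \<in> K \<Longrightarrow> f - g \<in> \<L>\<^sub>1"
  by (auto simp: L1_def)

lemma L1E:
  assumes "f \<in> \<L>\<^sub>1"
  obtains f1 f2 where "f1 \<in> K" "f2 \<in> K" "f = f1 - f2"
  using assms by (auto simp: L1_def)

lemma cone_in_L1: "f \<in> K \<Longrightarrow> f \<in> \<L>\<^sub>1"
  using L1I[of f 0] zero_in_cone by simp

lemma L1_nonneg_in_cone:
  assumes "f \<in> \<L>\<^sub>1" "0 \<le> f"
  shows "f \<in> K"
proof -
  obtain f1 f2 where "f1 \<in> K" "f2 \<in> K" "f = f1 - f2" using assms(1) by (rule L1E)
  then show ?thesis using cone_mono(1)[of f1 f] cone_nonneg[of f2] assms by simp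
qed

lemma L1_add:
  assumes "f \<in> \<L>\<^sub>1" "g \<in> \<L>\<^sub>1"
  shows "f + g \<in> \<L>\<^sub>1" "\<tau> (f + g) = \<tau> f + \<tau> g"
proof -
  obtain f1 f2 g1 g2 where *: "f1 \<in> K" "f2 \<in> K" "f = f1 - f2" "g1 \<in> K" "g2 \<in> K" "g = g1 - g2"
    using assms by (meson L1E)
  then have eq: "f + g = (f1 + g1) - (f2 + g2)" by simp
  show "f + g \<in> \<L>\<^sub>1" unfolding eq using * by (intro L1I cone_extension_add)
  show "\<tau> (f + g) = \<tau> f + \<tau> g"
    unfolding eq using * by (simp add: extended_diff cone_extension_add)
qed

lemma L1_uminus:
  assumes "f \<in> \<L>\<^sub>1"
  shows "- f \<in> \<L>\<^sub>1" "\<tau> (- f) = - \<tau> f"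
proof -
  obtain f1 f2 where *: "f1 \<in> K" "f2 \<in> K" "f = f1 - f2" using assms by (rule L1E)
  then show "- f \<in> \<L>\<^sub>1" "\<tau> (- f) = - \<tau> f"
    using L1I[of f2 f1] extended_diff[of f2 f1] extended_diff[of f1 f2] by simp_all
qed

lemma L1_diff:
  assumes "f \<in> \<L>\<^sub>1" "g \<in> \<L>\<^sub>1"
  shows "f - g \<in> \<L>\<^sub>1" "\<tau> (f - g) = \<tau> f - \<tau> g"
  using L1_add[OF assms(1) L1_uminus(1)[OF assms(2)]] L1_uminus(2)[OF assms(2)] by simp_all

lemma L1_scaleR:
  assumes "f \<in> \<L>\<^sub>1"
  shows "c *\<^sub>R f \<in> \<L>\<^sub>1" "\<tau> (c *\<^sub>R f) = c *\<^sub>R \<tau> f"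
proof -
  obtain f1 f2 where *: "f1 \<in> K" "f2 \<in> K" "f = f1 - f2" using assms by (rule L1E)
  have nn: "c *\<^sub>R f \<in> \<L>\<^sub>1 \<and> \<tau> (c *\<^sub>R f) = c *\<^sub>R \<tau> f" if "0 \<le> c" for c
  proof -
    have eq: "c *\<^sub>R f = c *\<^sub>R f1 - c *\<^sub>R f2" using * by (simp add: scaleR_diff_right)
    show ?thesis
      unfolding eq using * that L1I[of "c *\<^sub>R f1" "c *\<^sub>R f2"]
      by (simp add: extended_diff cone_extension_scaleR scaleR_diff_right)
  qed
  have "c *\<^sub>R f \<in> \<L>\<^sub>1 \<and> \<tau> (c *\<^sub>R f) = c *\<^sub>R \<tau> f"
  proof (cases "0 \<le> c")
    case False
    then have "(- c) *\<^sub>R f \<in> \<L>\<^sub>1 \<and> \<tau> ((- c) *\<^sub>R f) = (- c) *\<^sub>R \<tau> f" by (intro nn) simp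
    then show ?thesis using L1_uminus[of "(- c) *\<^sub>R f"] by simp
  qed (rule nn)
  then show "c *\<^sub>R f \<in> \<L>\<^sub>1" "\<tau> (c *\<^sub>R f) = c *\<^sub>R \<tau> f" by auto
qed

lemma extended_nonneg: "f \<in> \<L>\<^sub>1 \<Longrightarrow> 0 \<le> f \<Longrightarrow> 0 \<le> \<tau> f"
  using L1_nonneg_in_cone extended_cone cone_extension_nonneg by simp

lemma extended_mono: "f \<in> \<L>\<^sub>1 \<Longrightarrow> g \<in> \<L>\<^sub>1 \<Longrightarrow> f \<le> g \<Longrightarrow> \<tau> f \<le> \<tau> g"
  using extended_nonneg[of "g - f"] L1_diff[of g f] by simp

lemma extended_strict: "f \<in> \<L>\<^sub>1 \<Longrightarrow> 0 \<le> f \<Longrightarrow> \<tau> f = 0 \<Longrightarrow> f = 0"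
  using L1_nonneg_in_cone extended_cone cone_extension_strict by simp

lemma extended_idem:
  assumes "f \<in> \<L>\<^sub>1"
  shows "\<tau> f \<in> \<L>\<^sub>1" "\<tau> (\<tau> f) = \<tau> f"
proof -
  obtain f1 f2 where *: "f1 \<in> K" "f2 \<in> K" "f = f1 - f2" using assms by (rule L1E)
  then show "\<tau> f \<in> \<L>\<^sub>1" "\<tau> (\<tau> f) = \<tau> f"
    by (simp_all add: extended_diff L1I cone_extension_idem)
qed

lemma L1_pprt:
  assumes "f \<in> \<L>\<^sub>1"
  shows "pprt f \<in> \<L>\<^sub>1"
proof -
  obtain f1 f2 where *: "f1 \<in> K" "f2 \<in> K" "f = f1 - f2" using assms by (rule L1E)
  then have "pprt f \<le> f1" unfolding pprt_def using cone_nonneg by simp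
  then show ?thesis using cone_mono(1)[of f1 "pprt f"] * cone_in_L1 by simp
qed

lemma L1_nonneg_ideal:
  assumes "f \<in> \<L>\<^sub>1" "0 \<le> g" "g \<le> f"
  shows "g \<in> \<L>\<^sub>1"
proof -
  have "f \<in> K" by (rule L1_nonneg_in_cone[OF assms(1) order_trans[OF assms(2,3)]])
  then have "g \<in> K" using assms(2,3) by (rule cone_mono)
  then show ?thesis by (rule cone_in_L1)
qed

lemma L1_ideal:
  assumes f: "f \<in> \<L>\<^sub>1" and g: "g \<le> f" "- g \<le> f"
  shows "g \<in> \<L>\<^sub>1"
proof -
  have "pprt f \<in> \<L>\<^sub>1" using f by (rule L1_pprt)
  then have "pprt g \<in> \<L>\<^sub>1" "pprt (- g) \<in> \<L>\<^sub>1"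
    using g by (auto intro: L1_nonneg_ideal)
  then have "pprt g - pprt (- g) \<in> \<L>\<^sub>1" by (rule L1_diff)
  then show ?thesis using diff_pprts[of g] by simp
qed

section \<open>The range algebra as the set of fixed points\<close>

abbreviation "A \<equiv> range_algebra E T"

lemma range_algebra_iff: "a \<in> A \<longleftrightarrow> a \<in> \<L>\<^sub>1 \<and> \<tau> a = a"
proof
  assume "a \<in> A"
  then obtain f where "f \<in> \<L>\<^sub>1" "a = \<tau> f" by (auto simp: range_algebra_def)
  then show "a \<in> \<L>\<^sub>1 \<and> \<tau> a = a" using extended_idem by simp
next
  assume "a \<in> \<L>\<^sub>1 \<and> \<tau> a = a"
  then show "a \<in> A" unfolding range_algebra_def by (intro image_eqI[of _ _ a]) auto
qed

lemma range_algebra_add: "a \<in> A \<Longrightarrow> b \<in> A \<Longrightarrow> a + b \<in> A"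
  and range_algebra_uminus: "a \<in> A \<Longrightarrow> - a \<in> A"
  and range_algebra_scaleR: "a \<in> A \<Longrightarrow> c *\<^sub>R a \<in> A"
  by (simp_all add: range_algebra_iff L1_add L1_uminus L1_scaleR)

lemma unit_in_range_algebra: "e \<in> A"
  using unit_in_cone cone_extension_unit by (simp add: range_algebra_iff cone_in_L1 extended_cone)

text \<open>Comparability gives a sign to the difference of \<open>f\<close> and its expectation, as
  strict positivity requires. Positive parts use the inequality from below, square roots the one
  from above.\<close>

lemma fixed_if_le:
  assumes "f \<in> \<L>\<^sub>1" "f \<le> \<tau> f \<or> \<tau> f \<le> f"
  shows "f \<in> A"
proof -
  have "\<tau> (\<tau> f - f) = 0" "\<tau> (f - \<tau> f) = 0" "\<tau> f - f \<in> \<L>\<^sub>1" "f - \<tau> f \<in> \<L>\<^sub>1"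
    using assms(1) by (simp_all add: L1_diff extended_idem)
  then have "\<tau> f = f" using assms(2) extended_strict[of "\<tau> f - f"] extended_strict[of "f - \<tau> f"]
    by auto
  then show ?thesis using assms(1) by (simp add: range_algebra_iff)
qed

text \<open>The expectation of \<open>pprt a\<close> dominates \<open>0\<close> and the expectation
  of \<open>a\<close>, which is \<open>a\<close> itself, hence it dominates
  \<open>pprt a\<close>.\<close>

lemma range_algebra_pprt:
  assumes "a \<in> A"
  shows "pprt a \<in> A"
proof (rule fixed_if_le)
  have a: "a \<in> \<L>\<^sub>1" "\<tau> a = a" using assms by (simp_all add: range_algebra_iff)
  show p: "pprt a \<in> \<L>\<^sub>1" using a(1) by (rule L1_pprt)
  have "a \<le> \<tau> (pprt a)" using extended_mono[OF a(1) p] a(2) by (simp add: pprt_def)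
  then have "pprt a \<le> \<tau> (pprt a)"
    using extended_nonneg[OF p] by (simp add: pprt_def[of a])
  then show "pprt a \<le> \<tau> (pprt a) \<or> \<tau> (pprt a) \<le> pprt a" ..
qed

lemma range_algebra_sqrt:
  assumes "b \<in> A" "0 \<le> b"
  shows "\<exists>r\<in>A. 0 \<le> r \<and> r * r = b"
proof -
  define q where "q t = (1 / 2) *\<^sub>R ((1 / t) *\<^sub>R b + t *\<^sub>R e)" for t :: real
  define r where "r = Inf (q ` {0<..})"
  have r: "bdd_below (q ` {0<..})" "0 \<le> r" "r * r = b"
    using square_root[OF assms(2)] unfolding q_def r_def by auto
  have qA: "q t \<in> A" for t
    unfolding q_def using assms unit_in_range_algebra
    by (intro range_algebra_scaleR range_algebra_add)
  have rq: "r \<le> q t" if "0 < t" for t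
    unfolding r_def using that r by (intro cInf_lower) auto
  have rL: "r \<in> \<L>\<^sub>1"
    using L1_nonneg_ideal[of "q 1" r] qA rq r by (simp add: range_algebra_iff)
  have "\<tau> r \<le> q t" if "0 < t" for t
    using extended_mono[OF rL, of "q t"] qA[of t] rq[OF that] by (simp add: range_algebra_iff)
  then have "\<tau> r \<le> r" unfolding r_def by (intro cInf_greatest) auto
  then have "r \<in> A" using rL fixed_if_le by blast
  then show ?thesis using r by blast
qed

section \<open>The space H and its norm with values in the range algebra\<close>

abbreviation "H \<equiv> L2 E T"

lemma L2I: "x \<in> \<L>\<^sub>1 \<Longrightarrow> x * x \<in> \<L>\<^sub>1 \<Longrightarrow> x \<in> H"
  by (simp add: L2_def)

lemma L2_square: "x \<in> H \<Longrightarrow> x * x \<in> \<L>\<^sub>1"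
  by (simp add: L2_def)

lemma L2_scaleR: "x \<in> H \<Longrightarrow> c *\<^sub>R x \<in> H"
  by (auto simp: L2_def L1_scaleR)

lemma L2_add:
  assumes "x \<in> H" "y \<in> H"
  shows "x + y \<in> H"
proof (rule L2I)
  show "x + y \<in> \<L>\<^sub>1" using assms by (simp add: L2_def L1_add)
  have "2 *\<^sub>R (x * x + y * y) \<in> \<L>\<^sub>1" using assms by (simp add: L2_def L1_add L1_scaleR)
  then show "(x + y) * (x + y) \<in> \<L>\<^sub>1"
    by (rule L1_nonneg_ideal) (rule square_nonneg, rule square_add_le)
qed

lemma L2_uminus: "x \<in> H \<Longrightarrow> - x \<in> H"
  using L2_scaleR[of x "- 1"] by simp

lemma L2_diff: "x \<in> H \<Longrightarrow> y \<in> H \<Longrightarrow> x - y \<in> H"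
  using L2_add[of x "- y"] L2_uminus[of y] by simp

lemma L2_zero: "0 \<in> H"
  using L1_diff(1)[OF cone_in_L1 cone_in_L1, OF zero_in_cone zero_in_cone] by (simp add: L2_def)

lemma L2_ideal:
  assumes x: "x \<in> H" and y: "y \<le> x" "- y \<le> x"
  shows "y \<in> H"
proof (rule L2I)
  show "y \<in> \<L>\<^sub>1" using L1_ideal[OF _ y] x by (simp add: L2_def)
  show "y * y \<in> \<L>\<^sub>1"
    using L2_square[OF x] square_nonneg square_le_if_bounds[OF y] by (rule L1_nonneg_ideal)
qed

lemma L2_nonneg_ideal: "x \<in> H \<Longrightarrow> 0 \<le> y \<Longrightarrow> y \<le> x \<Longrightarrow> y \<in> H"
  by (erule L2_ideal) (auto intro: order_trans[of _ 0])

lemma L2_sup_uminus: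
  assumes "x \<in> H"
  shows "sup x (- x) \<in> H"
proof (rule L2I)
  have "x \<in> \<L>\<^sub>1" "- x \<in> \<L>\<^sub>1" using assms by (simp_all add: L2_def L1_uminus)
  then show "sup x (- x) \<in> \<L>\<^sub>1" unfolding sup_uminus_eq_pprts by (intro L1_add L1_pprt)
  show "sup x (- x) * sup x (- x) \<in> \<L>\<^sub>1"
    using L2_square[OF assms] by (simp only: square_sup_uminus)
qed

lemma L2_pprt: "x \<in> H \<Longrightarrow> pprt x \<in> H"
  by (rule L2_nonneg_ideal[OF L2_sup_uminus]) (auto simp: sup_uminus_eq_pprts)

abbreviation "\<nu> \<equiv> norm_T2 E T"

text \<open>This unlocks the definite description: the root exists by
  \<open>range_algebra_sqrt\<close> and is unique because squaring is order reflecting on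
  nonnegative elements.\<close>

lemma norm_T2:
  assumes "x \<in> H"
  shows "\<nu> x \<in> A" "0 \<le> \<nu> x" "\<nu> x * \<nu> x = \<tau> (x * x)"
proof -
  have sq: "x * x \<in> \<L>\<^sub>1" using assms by (rule L2_square)
  then have "\<tau> (x * x) \<in> A" "0 \<le> \<tau> (x * x)"
    using extended_idem extended_nonneg square_nonneg by (auto simp: range_algebra_iff)
  then obtain r where r: "r \<in> A \<and> 0 \<le> r \<and> r * r = \<tau> (x * x)"
    using range_algebra_sqrt by blast
  have "\<nu> x \<in> A \<and> 0 \<le> \<nu> x \<and> \<nu> x * \<nu> x = \<tau> (x * x)"
    unfolding norm_T2_def
  proof (rule theI)
    show "s = r" if "s \<in> A \<and> 0 \<le> s \<and> s * s = \<tau> (x * x)" for s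
      by (rule order.antisym; rule square_le_imp_le) (use that r in auto)
  qed (rule r)
  then show "\<nu> x \<in> A" "0 \<le> \<nu> x" "\<nu> x * \<nu> x = \<tau> (x * x)" by auto
qed

lemma norm_T2_le:
  assumes "x \<in> H" "0 \<le> c" "\<tau> (x * x) \<le> c * c"
  shows "\<nu> x \<le> c"
  by (rule square_le_imp_le) (use norm_T2[OF assms(1)] assms(2,3) in auto)

lemma norm_T2_mono:
  assumes "x \<in> H" "y \<le> x" "- y \<le> x"
  shows "\<nu> y \<le> \<nu> x"
proof (rule norm_T2_le)
  show y: "y \<in> H" using assms by (rule L2_ideal)
  show "0 \<le> \<nu> x" using assms(1) by (rule norm_T2)
  show "\<tau> (y * y) \<le> \<nu> x * \<nu> x"
    unfolding norm_T2(3)[OF assms(1)] using assms y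
    by (intro extended_mono L2_square square_le_if_bounds)
qed

text \<open>The norm depends on \<open>x\<close> only through \<open>x * x\<close>, which the
  absolute value does not change.\<close>

lemma norm_T2_sup_uminus: "\<nu> (sup x (- x)) = \<nu> x"
  unfolding norm_T2_def square_sup_uminus ..

end

section \<open>Suprema of finite subfamilies\<close>

text \<open>Carrier and relation are kept abstract because \<open>op_le\<close> compares values on
  nonnegative elements of \<open>H\<close> only and is in general not antisymmetric on all
  functions.\<close>

lemma finite_sup_exists:
  assumes trans: "\<And>R Q V. R \<in> X \<Longrightarrow> Q \<in> X \<Longrightarrow> V \<in> X \<Longrightarrow> le R Q \<Longrightarrow> le Q V \<Longrightarrow> le R V"
    and sups: "\<And>R Q. R \<in> X \<Longrightarrow> Q \<in> X \<Longrightarrow> \<exists>V. is_sup_on le X {R, Q} V"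
    and "finite G" "G \<noteq> {}" "G \<subseteq> X"
  shows "\<exists>V. is_sup_on le X G V"
  using assms(3-5)
proof (induction rule: finite_ne_induct)
  case (singleton R)
  then show ?case using sups[of R R] by simp
next
  case (insert R G)
  then obtain W where W: "is_sup_on le X G W" by auto
  then have WX: "W \<in> X" by (simp add: is_sup_on_def)
  obtain V where V: "is_sup_on le X {R, W} V" using sups[of R W] WX insert by auto
  have "le Q V" if "Q \<in> G" for Q
    using trans[of Q W V] V W WX that insert by (auto simp: is_sup_on_def)
  then have "is_sup_on le X (insert R G) V"
    using V W WX unfolding is_sup_on_def by auto
  then show ?case by blast
qed

text \<open>Two finite suprema are dominated by the supremum over the union of their index
  sets.\<close>

lemma finite_sups_directed:
  assumes refl: "\<And>R. R \<in> X \<Longrightarrow> le R R"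
    and trans: "\<And>R Q V. R \<in> X \<Longrightarrow> Q \<in> X \<Longrightarrow> V \<in> X \<Longrightarrow> le R Q \<Longrightarrow> le Q V \<Longrightarrow> le R V"
    and sups: "\<And>R Q. R \<in> X \<Longrightarrow> Q \<in> X \<Longrightarrow> \<exists>V. is_sup_on le X {R, Q} V"
    and F: "F \<noteq> {}" "F \<subseteq> X"
  shows "directed_on le (finite_sups le X F)"
  unfolding directed_on_def
proof (intro conjI ballI impI)
  have X: "V \<in> X" if "V \<in> finite_sups le X F" for V
    using that by (auto simp: finite_sups_def is_sup_on_def)
  obtain R where R: "R \<in> F" using F by blast
  obtain V where "is_sup_on le X {R} V"
    using sups[of R R] R F by auto
  then have "V \<in> finite_sups le X F"
    unfolding finite_sups_def using R by (intro CollectI exI[of _ "{R}"]) auto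
  then show "finite_sups le X F \<noteq> {}" by blast
  show "le V V" if "V \<in> finite_sups le X F" for V using X[OF that] by (rule refl)
  show "le U W" if "U \<in> finite_sups le X F" "V \<in> finite_sups le X F" "W \<in> finite_sups le X F"
      "le U V" "le V W" for U V W
    using X[OF that(1)] X[OF that(2)] X[OF that(3)] that(4,5) by (rule trans)
  fix U V assume U: "U \<in> finite_sups le X F" and V: "V \<in> finite_sups le X F"
  then obtain G1 G2 where G: "finite G1" "G1 \<noteq> {}" "G1 \<subseteq> F" "is_sup_on le X G1 U"
    "finite G2" "G2 \<noteq> {}" "G2 \<subseteq> F" "is_sup_on le X G2 V" by (auto simp: finite_sups_def)
  have "\<exists>W. is_sup_on le X (G1 \<union> G2) W"
    by (rule finite_sup_exists[OF trans sups]) (use G F in auto)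
  then obtain W where W: "is_sup_on le X (G1 \<union> G2) W" by blast
  have "le U W" "le V W" using G(4,8) W unfolding is_sup_on_def by blast+
  moreover have "W \<in> finite_sups le X F"
    unfolding finite_sups_def using G W by (intro CollectI exI[of _ "G1 \<union> G2"]) auto
  ultimately show "\<exists>W\<in>finite_sups le X F. le U W \<and> le V W" by blast
qed

text \<open>Both sets have the same upper bounds in \<open>X\<close>: the singletons are among the
  finite subsets, and a finite supremum lies below every bound of its subset.\<close>

lemma is_sup_on_finite_sups_iff:
  assumes trans: "\<And>R Q V. R \<in> X \<Longrightarrow> Q \<in> X \<Longrightarrow> V \<in> X \<Longrightarrow> le R Q \<Longrightarrow> le Q V \<Longrightarrow> le R V"
    and sups: "\<And>R Q. R \<in> X \<Longrightarrow> Q \<in> X \<Longrightarrow> \<exists>V. is_sup_on le X {R, Q} V"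
    and F: "F \<subseteq> X"
  shows "is_sup_on le X (finite_sups le X F) S \<longleftrightarrow> is_sup_on le X F S"
proof -
  have "(\<forall>V\<in>finite_sups le X F. le V U) \<longleftrightarrow> (\<forall>R\<in>F. le R U)" if U: "U \<in> X" for U
  proof
    assume *: "\<forall>V\<in>finite_sups le X F. le V U"
    show "\<forall>R\<in>F. le R U"
    proof
      fix R assume R: "R \<in> F"
      obtain V where V: "is_sup_on le X {R} V"
        using sups[of R R] R F by auto
      then have "V \<in> finite_sups le X F" unfolding finite_sups_def using R
        by (intro CollectI exI[of _ "{R}"]) auto
      then have "le V U" using * by blast
      moreover have "V \<in> X" "le R V" using V by (auto simp: is_sup_on_def)
      moreover have "R \<in> X" using R F by blast
      ultimately show "le R U" using trans U by blast
    qed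
  next
    assume "\<forall>R\<in>F. le R U"
    then show "\<forall>V\<in>finite_sups le X F. le V U"
      using U unfolding finite_sups_def is_sup_on_def by blast
  qed
  then show ?thesis unfolding is_sup_on_def by blast
qed

section \<open>Regular operators\<close>

context riesz_conditional_expectation
begin

lemma op_le_iff: "op_le E T R Q \<longleftrightarrow> (\<forall>x\<in>H. 0 \<le> x \<longrightarrow> R x \<le> Q x)"
  by (simp add: op_le_def order_positive_def)

abbreviation "\<B> \<equiv> bounded_ops E T"
abbreviation "\<P> \<equiv> positive_ops E T"
abbreviation "\<R> \<equiv> regular_ops E T"

lemma bounded_opsD:
  assumes "S \<in> \<B>"
  shows "x \<notin> H \<Longrightarrow> S x = 0"
    and "x \<in> H \<Longrightarrow> S x \<in> H"
    and "x \<in> H \<Longrightarrow> y \<in> H \<Longrightarrow> S (x + y) = S x + S y"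
    and "a \<in> A \<Longrightarrow> x \<in> H \<Longrightarrow> S (a * x) = a * S x"
    and "\<exists>k\<in>A. 0 \<le> k \<and> (\<forall>x\<in>H. \<nu> (S x) \<le> k * \<nu> x)"
  using assms by (simp_all add: bounded_ops_def)

text \<open>Real multiples of the unit lie in \<open>A\<close>, so real homogeneity is a case of
  \<open>A\<close>-homogeneity.\<close>

lemma bounded_ops_scaleR_arg:
  assumes "S \<in> \<B>" "x \<in> H"
  shows "S (c *\<^sub>R x) = c *\<^sub>R S x"
proof -
  have "c *\<^sub>R e \<in> A" by (intro range_algebra_scaleR unit_in_range_algebra)
  from bounded_opsD(4)[OF assms(1) this assms(2)] show ?thesis
    by (simp only: scaleR_unit_mult)
qed

lemma bounded_ops_zero_arg: "S \<in> \<B> \<Longrightarrow> S 0 = 0"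
  using bounded_ops_scaleR_arg[of S 0 0] L2_zero by simp

lemma bounded_ops_diff_arg:
  assumes "S \<in> \<B>" "x \<in> H" "y \<in> H"
  shows "S (x - y) = S x - S y"
  using bounded_opsD(3)[OF assms(1) L2_diff[OF assms(2,3)] assms(3)] by simp

text \<open>The constant comes from comparing squares. \<open>square_add_le\<close> gives twice the
  sum of the squares of \<open>?u\<close> and \<open>?v\<close>, which is at most the square of
  \<open>2 *\<^sub>R (?u + ?v)\<close>.\<close>

lemma bounded_ops_add:
  assumes R: "R \<in> \<B>" and Q: "Q \<in> \<B>"
  shows "(\<lambda>x. R x + Q x) \<in> \<B>"
proof -
  obtain k l where k: "k \<in> A" "0 \<le> k" "\<And>x. x \<in> H \<Longrightarrow> \<nu> (R x) \<le> k * \<nu> x"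
    and l: "l \<in> A" "0 \<le> l" "\<And>x. x \<in> H \<Longrightarrow> \<nu> (Q x) \<le> l * \<nu> x"
    using bounded_opsD(5)[OF R] bounded_opsD(5)[OF Q] by blast
  have "\<nu> (R x + Q x) \<le> (2 *\<^sub>R (k + l)) * \<nu> x" if x: "x \<in> H" for x
  proof (rule norm_T2_le)
    let ?u = "k * \<nu> x" and ?v = "l * \<nu> x"
    have H: "R x \<in> H" "Q x \<in> H" using R Q x bounded_opsD(2) by blast+
    have u: "0 \<le> ?u" "0 \<le> ?v" using k l norm_T2(2)[OF x] by (auto intro: mult_nonneg_nonneg)
    have uv: "0 \<le> ?u * ?u + ?v * ?v + 2 *\<^sub>R (2 *\<^sub>R (?u * ?v))"
      by (intro add_nonneg_nonneg scaleR_nonneg_nonneg square_nonneg mult_nonneg_nonneg[OF u]) auto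
    show "R x + Q x \<in> H" using H by (rule L2_add)
    show "0 \<le> (2 *\<^sub>R (k + l)) * \<nu> x"
      using k l norm_T2(2)[OF x]
      by (intro mult_nonneg_nonneg scaleR_nonneg_nonneg add_nonneg_nonneg) auto
    have "\<tau> ((R x + Q x) * (R x + Q x)) \<le> \<tau> (2 *\<^sub>R (R x * R x + Q x * Q x))"
      using H by (intro extended_mono square_add_le L2_square L2_add L1_scaleR L1_add)
    also have "\<dots> = 2 *\<^sub>R (\<nu> (R x) * \<nu> (R x) + \<nu> (Q x) * \<nu> (Q x))"
      using H by (simp add: L1_scaleR L1_add L2_square norm_T2(3))
    also have "\<dots> \<le> 2 *\<^sub>R (?u * ?u + ?v * ?v)"
      using H k(3)[OF x] l(3)[OF x] by (intro scaleR_left_mono add_mono square_mono norm_T2(2)) auto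
    also have "\<dots> \<le> 2 *\<^sub>R (?u * ?u + ?v * ?v) + 2 *\<^sub>R (?u * ?u + ?v * ?v + 2 *\<^sub>R (2 *\<^sub>R (?u * ?v)))"
      using uv by (simp add: scaleR_nonneg_nonneg)
    also have "\<dots> = ((2 *\<^sub>R (k + l)) * \<nu> x) * ((2 *\<^sub>R (k + l)) * \<nu> x)"
    proof -
      have "(2 *\<^sub>R (k + l)) * \<nu> x = 2 *\<^sub>R (?u + ?v)" by (simp add: distrib_right)
      moreover have "(?u + ?v) * (?u + ?v) = ?u * ?u + ?v * ?v + 2 *\<^sub>R (?u * ?v)"
        by (simp only: distrib_left distrib_right scaleR_2 mult.commute[of ?v ?u] add_ac)
      ultimately have "((2 *\<^sub>R (k + l)) * \<nu> x) * ((2 *\<^sub>R (k + l)) * \<nu> x) =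
        4 *\<^sub>R (?u * ?u + ?v * ?v + 2 *\<^sub>R (?u * ?v))" by simp
      also have "\<dots> = (2 + 2) *\<^sub>R (?u * ?u + ?v * ?v) + 8 *\<^sub>R (?u * ?v)"
        by (simp add: scaleR_add_right)
      also have "\<dots> = 2 *\<^sub>R (?u * ?u + ?v * ?v) + (2 *\<^sub>R (?u * ?u + ?v * ?v) + 8 *\<^sub>R (?u * ?v))"
        by (simp only: scaleR_left_distrib add.assoc)
      finally show ?thesis by (simp add: scaleR_add_right)
    qed
    finally show "\<tau> ((R x + Q x) * (R x + Q x)) \<le>
      ((2 *\<^sub>R (k + l)) * \<nu> x) * ((2 *\<^sub>R (k + l)) * \<nu> x)" .
  qed
  moreover have "2 *\<^sub>R (k + l) \<in> A" "0 \<le> 2 *\<^sub>R (k + l)"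
    using k l by (auto intro: range_algebra_scaleR range_algebra_add scaleR_nonneg_nonneg)
  ultimately have "\<exists>k\<in>A. 0 \<le> k \<and> (\<forall>x\<in>H. \<nu> (R x + Q x) \<le> k * \<nu> x)" by blast
  then show ?thesis
    unfolding bounded_ops_def mem_Collect_eq
    using bounded_opsD(1-4)[OF R] bounded_opsD(1-4)[OF Q] L2_add
    by (simp add: distrib_left add_ac)
qed

lemma bounded_ops_scaleR:
  assumes R: "R \<in> \<B>"
  shows "(\<lambda>x. c *\<^sub>R R x) \<in> \<B>"
proof -
  obtain k where k: "k \<in> A" "0 \<le> k" "\<And>x. x \<in> H \<Longrightarrow> \<nu> (R x) \<le> k * \<nu> x"
    using bounded_opsD(5)[OF R] by blast
  have "\<nu> (c *\<^sub>R R x) \<le> (\<bar>c\<bar> *\<^sub>R k) * \<nu> x" if x: "x \<in> H" for x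
  proof (rule norm_T2_le)
    have H: "R x \<in> H" using R x bounded_opsD(2) by blast
    show "c *\<^sub>R R x \<in> H" using H by (rule L2_scaleR)
    show "0 \<le> (\<bar>c\<bar> *\<^sub>R k) * \<nu> x"
      using k norm_T2(2)[OF x] by (intro mult_nonneg_nonneg scaleR_nonneg_nonneg) auto
    have "\<tau> ((c *\<^sub>R R x) * (c *\<^sub>R R x)) = (c * c) *\<^sub>R (\<nu> (R x) * \<nu> (R x))"
      using H by (simp add: L1_scaleR L2_square norm_T2(3))
    also have "\<dots> \<le> (c * c) *\<^sub>R ((k * \<nu> x) * (k * \<nu> x))"
      using H k(3)[OF x] by (intro scaleR_left_mono square_mono norm_T2(2)) auto
    also have "\<dots> = ((\<bar>c\<bar> *\<^sub>R k) * \<nu> x) * ((\<bar>c\<bar> *\<^sub>R k) * \<nu> x)" by simp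
    finally show "\<tau> ((c *\<^sub>R R x) * (c *\<^sub>R R x)) \<le>
      ((\<bar>c\<bar> *\<^sub>R k) * \<nu> x) * ((\<bar>c\<bar> *\<^sub>R k) * \<nu> x)" .
  qed
  moreover have "\<bar>c\<bar> *\<^sub>R k \<in> A" "0 \<le> \<bar>c\<bar> *\<^sub>R k"
    using k by (auto intro: range_algebra_scaleR scaleR_nonneg_nonneg)
  ultimately have "\<exists>k\<in>A. 0 \<le> k \<and> (\<forall>x\<in>H. \<nu> (c *\<^sub>R R x) \<le> k * \<nu> x)" by blast
  then show ?thesis
    unfolding bounded_ops_def mem_Collect_eq
    using bounded_opsD(1-4)[OF R] L2_scaleR by (simp add: scaleR_add_right)
qed

lemma bounded_ops_diff:
  assumes "R \<in> \<B>" "Q \<in> \<B>"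
  shows "(\<lambda>x. R x - Q x) \<in> \<B>"
  using bounded_ops_add[OF assms(1) bounded_ops_scaleR[OF assms(2), of "- 1"]] by simp

lemma positive_opsD:
  assumes "P \<in> \<P>"
  shows "P \<in> \<B>" "x \<in> H \<Longrightarrow> 0 \<le> x \<Longrightarrow> 0 \<le> P x"
  using assms by (simp_all add: positive_ops_def order_positive_def)

lemma positive_ops_mono:
  assumes "P \<in> \<P>" "x \<in> H" "y \<in> H" "x \<le> y"
  shows "P x \<le> P y"
proof -
  have "0 \<le> P (y - x)" 
    using positive_opsD(2)[OF assms(1) L2_diff[OF assms(3,2)]] assms(4) by simp
  then show ?thesis
    using bounded_ops_diff_arg[OF positive_opsD(1)[OF assms(1)] assms(3,2)] by simp
qed

lemma positive_ops_add: "P \<in> \<P> \<Longrightarrow> Q \<in> \<P> \<Longrightarrow> (\<lambda>x. P x + Q x) \<in> \<P>"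
  by (simp add: positive_ops_def order_positive_def bounded_ops_add)

lemma positive_ops_scaleR: "P \<in> \<P> \<Longrightarrow> 0 \<le> c \<Longrightarrow> (\<lambda>x. c *\<^sub>R P x) \<in> \<P>"
  by (simp add: positive_ops_def order_positive_def bounded_ops_scaleR scaleR_nonneg_nonneg)

lemma zero_in_positive_ops: "(\<lambda>x. 0) \<in> \<P>"
proof -
  have "\<nu> 0 \<le> 0 * \<nu> x" for x
    by (rule norm_T2_le) (use L2_zero L1_scaleR(2)[OF cone_in_L1[OF zero_in_cone], of 0] in auto)
  moreover have "0 \<in> A" using range_algebra_scaleR[OF unit_in_range_algebra, of 0] by simp
  ultimately have "\<exists>k\<in>A. 0 \<le> k \<and> (\<forall>x\<in>H. \<nu> 0 \<le> k * \<nu> x)" by (intro bexI[of _ 0]) auto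
  then show ?thesis by (simp add: positive_ops_def order_positive_def bounded_ops_def L2_zero)
qed

lemma regular_opsI: "P \<in> \<P> \<Longrightarrow> Q \<in> \<P> \<Longrightarrow> (\<lambda>x. P x - Q x) \<in> \<R>"
  by (auto simp: regular_ops_def)

lemma regular_opsE:
  assumes "R \<in> \<R>"
  obtains P Q where "P \<in> \<P>" "Q \<in> \<P>" "R = (\<lambda>x. P x - Q x)"
  using assms by (auto simp: regular_ops_def)

lemma positive_in_regular_ops: "P \<in> \<P> \<Longrightarrow> P \<in> \<R>"
  using regular_opsI[OF _ zero_in_positive_ops] by simp

lemma regular_in_bounded_ops: "R \<in> \<R> \<Longrightarrow> R \<in> \<B>"
  by (erule regular_opsE) (simp add: bounded_ops_diff positive_opsD)

lemma regular_ops_add: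
  assumes "R \<in> \<R>" "Q \<in> \<R>"
  shows "(\<lambda>x. R x + Q x) \<in> \<R>"
proof -
  obtain R1 R2 Q1 Q2 where *: "R1 \<in> \<P>" "R2 \<in> \<P>" "R = (\<lambda>x. R1 x - R2 x)"
    "Q1 \<in> \<P>" "Q2 \<in> \<P>" "Q = (\<lambda>x. Q1 x - Q2 x)"
    using assms by (meson regular_opsE)
  then have "(\<lambda>x. (R1 x + Q1 x) - (R2 x + Q2 x)) \<in> \<R>"
    by (intro regular_opsI positive_ops_add)
  then show ?thesis using * by (simp add: algebra_simps)
qed

lemma regular_ops_uminus:
  assumes "R \<in> \<R>"
  shows "(\<lambda>x. - R x) \<in> \<R>"
proof -
  obtain P Q where "P \<in> \<P>" "Q \<in> \<P>" "R = (\<lambda>x. P x - Q x)" using assms by (rule regular_opsE)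
  then show ?thesis using regular_opsI[of Q P] by simp
qed

lemma regular_ops_diff: "R \<in> \<R> \<Longrightarrow> Q \<in> \<R> \<Longrightarrow> (\<lambda>x. R x - Q x) \<in> \<R>"
  using regular_ops_add[OF _ regular_ops_uminus] by simp

lemma regular_ops_scaleR:
  assumes "R \<in> \<R>"
  shows "(\<lambda>x. c *\<^sub>R R x) \<in> \<R>"
proof -
  obtain P Q where PQ: "P \<in> \<P>" "Q \<in> \<P>" "R = (\<lambda>x. P x - Q x)" using assms by (rule regular_opsE)
  have nn: "(\<lambda>x. c *\<^sub>R R x) \<in> \<R>" if "0 \<le> c" for c
    using regular_opsI[OF positive_ops_scaleR positive_ops_scaleR, OF PQ(1) that PQ(2) that] PQ(3)
    by (simp add: scaleR_diff_right)
  show ?thesis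
  proof (cases "0 \<le> c")
    case False
    then have "(\<lambda>x. - ((- c) *\<^sub>R R x)) \<in> \<R>" by (intro regular_ops_uminus nn) simp
    then show ?thesis by simp
  qed (rule nn)
qed

lemma regular_op_positive: "R \<in> \<R> \<Longrightarrow> (\<And>x. x \<in> H \<Longrightarrow> 0 \<le> x \<Longrightarrow> 0 \<le> R x) \<Longrightarrow> R \<in> \<P>"
  by (simp add: positive_ops_def order_positive_def regular_in_bounded_ops)

text \<open>The order determines values on nonnegative elements, additivity extends them to
  \<open>H\<close> through positive parts, and outside \<open>H\<close> both representatives
  vanish.\<close>

lemma op_le_antisym:
  assumes "R \<in> \<R>" "Q \<in> \<R>" "op_le E T R Q" "op_le E T Q R"
  shows "R = Q"
proof
  fix x
  have B: "R \<in> \<B>" "Q \<in> \<B>" using assms regular_in_bounded_ops by auto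
  have eq: "R y = Q y" if "y \<in> H" "0 \<le> y" for y
    using that assms by (intro order.antisym) (auto simp: op_le_iff)
  show "R x = Q x"
  proof (cases "x \<in> H")
    case True
    then have H: "pprt x \<in> H" "pprt (- x) \<in> H" by (auto intro: L2_pprt L2_uminus)
    have dec: "S x = S (pprt x) - S (pprt (- x))" if "S \<in> \<B>" for S
      using bounded_ops_diff_arg[OF that H] diff_pprts[of x] by simp
    show ?thesis
      unfolding dec[OF B(1)] dec[OF B(2)] using eq[OF H(1)] eq[OF H(2)] by simp
  next
    case False
    then show ?thesis using bounded_opsD(1)[OF B(1)] bounded_opsD(1)[OF B(2)] by simp
  qed
qed

lemma op_sup_unique:
  assumes "is_sup_on (op_le E T) \<R> D S" "is_sup_on (op_le E T) \<R> D S'"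
  shows "S = S'"
  using assms by (intro op_le_antisym) (auto simp: is_sup_on_def)

text \<open>The domination by a positive operator yields the norm bound. It also settles homogeneity
  when \<open>a * x\<close> lies outside \<open>H\<close>, where both sides have to vanish.\<close>

lemma positive_op_extension:
  assumes P: "P \<in> \<P>"
    and p0: "\<And>x. x \<in> H \<Longrightarrow> 0 \<le> x \<Longrightarrow> 0 \<le> p x"
    and pP: "\<And>x. x \<in> H \<Longrightarrow> 0 \<le> x \<Longrightarrow> p x \<le> P x"
    and padd: "\<And>x y. x \<in> H \<Longrightarrow> 0 \<le> x \<Longrightarrow> y \<in> H \<Longrightarrow> 0 \<le> y \<Longrightarrow> p (x + y) = p x + p y"
    and phom: "\<And>a x. a \<in> A \<Longrightarrow> 0 \<le> a \<Longrightarrow> x \<in> H \<Longrightarrow> 0 \<le> x \<Longrightarrow> a * x \<in> H \<Longrightarrow>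
      p (a * x) = a * p x"
  shows "\<exists>V\<in>\<P>. \<forall>x\<in>H. 0 \<le> x \<longrightarrow> V x = p x"
proof -
  define V where "V x = (if x \<in> H then p (pprt x) - p (pprt (- x)) else 0)" for x
  have PB: "P \<in> \<B>" using P by (rule positive_opsD)
  have parts: "pprt x \<in> H" "pprt (- x) \<in> H" if "x \<in> H" for x
    using that by (auto intro: L2_pprt L2_uminus)
  have pz: "p 0 = 0" using padd[of 0 0] L2_zero by simp
  have Vp: "V x = p x" if "x \<in> H" "0 \<le> x" for x
    using that pz by (simp add: V_def)
  have pH: "p x \<in> H" if "x \<in> H" "0 \<le> x" for x
    using bounded_opsD(2)[OF PB that(1)] p0[OF that] pP[OF that] by (rule L2_nonneg_ideal)
  \<comment> \<open>Any representation of an element as a difference of nonnegative ones gives the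
    same value, because \<open>pprt ?x + z = pprt (- ?x) + y\<close> and \<open>p\<close> is
    additive.\<close>
  have Vdiff: "V (y - z) = p y - p z" if "y \<in> H" "0 \<le> y" "z \<in> H" "0 \<le> z" for y z
  proof -
    let ?x = "y - z"
    have x: "?x \<in> H" using that by (intro L2_diff)
    have "pprt ?x + z = (pprt ?x - pprt (- ?x)) + (pprt (- ?x) + z)" by simp
    also have "\<dots> = ?x + (pprt (- ?x) + z)" using diff_pprts[of ?x] by simp
    finally have "pprt ?x + z = pprt (- ?x) + y" by simp
    then have "p (pprt ?x) + p z = p (pprt (- ?x)) + p y"
      using padd[of "pprt ?x" z] padd[of "pprt (- ?x)" y] parts[OF x] that by simp
    then have "p (pprt ?x) = p (pprt (- ?x)) + p y - p z" by (simp only: eq_diff_eq)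
    then show ?thesis using x by (simp add: V_def)
  qed
  have VH: "V x \<in> H" if "x \<in> H" for x
    using that parts[OF that] by (simp add: V_def L2_diff pH)
  have Vadd: "V (x + y) = V x + V y" if "x \<in> H" "y \<in> H" for x y
  proof -
    note px = parts[OF that(1)] and py = parts[OF that(2)]
    have "(pprt x + pprt y) - (pprt (- x) + pprt (- y)) =
        (pprt x - pprt (- x)) + (pprt y - pprt (- y))" by simp
    then have "(pprt x + pprt y) - (pprt (- x) + pprt (- y)) = x + y"
      using diff_pprts[of x] diff_pprts[of y] by simp
    then have "V (x + y) = p (pprt x + pprt y) - p (pprt (- x) + pprt (- y))"
      using Vdiff[of "pprt x + pprt y" "pprt (- x) + pprt (- y)"] px py
      by (simp add: L2_add add_nonneg_nonneg)
    also have "\<dots> = p (pprt x) + p (pprt y) - (p (pprt (- x)) + p (pprt (- y)))"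
      using px py by (simp add: padd)
    finally show ?thesis using that by (simp add: V_def)
  qed
  \<comment> \<open>\<open>P\<close> vanishes outside \<open>H\<close>, so its homogeneity forces
    \<open>a * P x = 0\<close>. The products of \<open>a\<close> with the two parts of
    \<open>x\<close> cannot both lie in \<open>H\<close>, so \<open>a * P\<close> vanishes on one
    part, and then on the other by subtraction. Domination passes this to \<open>p\<close>.\<close>
  have vanish: "a * p (pprt x) = 0" if a: "a \<in> A" and x: "x \<in> H" and ax: "a * x \<notin> H" for a x
  proof -
    note px = parts[OF x]
    have aP: "a * P (pprt x) = a * P x + a * P (pprt (- x))"
      using bounded_ops_diff_arg[OF PB px] diff_pprts[of x] by (simp add: right_diff_distrib)
    have "a * P x = 0" using bounded_opsD(1,4)[OF PB] a x ax by metis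
    moreover have "a * P (pprt x) = 0 \<or> a * P (pprt (- x)) = 0"
    proof (rule ccontr)
      assume "\<not> ?thesis"
      then have "a * pprt x \<in> H" "a * pprt (- x) \<in> H"
        using bounded_opsD(1,4)[OF PB] a px by metis+
      then have "a * pprt x - a * pprt (- x) \<in> H" by (rule L2_diff)
      then show False using ax diff_pprts[of x] by (simp add: right_diff_distrib[symmetric])
    qed
    ultimately have aP0: "a * P (pprt x) = 0" using aP by auto
    \<comment> \<open>Multiplying \<open>p \<le> P\<close> needs a nonnegative factor, so
      \<open>a\<close> is split and this is used for \<open>b = a\<close> and
      \<open>b = - a\<close>. The nonnegative value of \<open>P\<close> can be moved inside the
      positive part.\<close>
    have z: "pprt b * p (pprt x) = 0" if "b * P (pprt x) = 0" for b
    proof -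
      have "P (pprt x) * pprt b = pprt (P (pprt x) * b)"
        using positive_opsD(2)[OF P px(1)] by (intro mult_pprt) simp
      then have "pprt b * P (pprt x) = 0" using that by (simp add: mult.commute)
      moreover have "pprt b * p (pprt x) \<le> pprt b * P (pprt x)"
        using px by (intro mult_left_mono pP) auto
      moreover have "0 \<le> pprt b * p (pprt x)" using px p0 by (intro mult_nonneg_nonneg) auto
      ultimately show ?thesis by simp
    qed
    have "a * p (pprt x) = (pprt a - pprt (- a)) * p (pprt x)" using diff_pprts[of a] by simp
    also have "\<dots> = 0" using z[of a] z[of "- a"] aP0 by (simp add: left_diff_distrib)
    finally show ?thesis .
  qed
  have Vhom: "V (a * x) = a * V x" if a: "a \<in> A" and x: "x \<in> H" for a x
  proof (cases "a * x \<in> H")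
    case False
    have "a * p (pprt x) = 0" using vanish a x False by blast
    moreover have "a * p (pprt (- x)) = 0"
    proof (rule vanish[OF a L2_uminus[OF x]])
      show "a * - x \<notin> H" using L2_uminus[of "a * - x"] False by auto
    qed
    ultimately show ?thesis using False x by (simp add: V_def right_diff_distrib)
  next
    case True
    note px = parts[OF x]
    have pa: "pprt a \<in> A" "pprt (- a) \<in> A"
      using a by (auto intro: range_algebra_pprt range_algebra_uminus)
    \<comment> \<open>Each of the four products of parts of \<open>a\<close> and \<open>x\<close>
      lies below the positive part of \<open>a * x\<close> or of its negative, so it stays in the
      ideal \<open>H\<close>.\<close>
    have mem: "pprt b * pprt y \<in> H" if "b * y = a * x \<or> b * y = - (a * x)" for b y
    proof (rule L2_nonneg_ideal)
      have "b * y \<in> H" using that True L2_uminus[OF True] by metis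
      then show "pprt (b * y) \<in> H" by (rule L2_pprt)
      show "0 \<le> pprt b * pprt y" by (simp add: mult_nonneg_nonneg)
    qed (rule pprt_mult_le)
    have m: "pprt a * pprt x \<in> H" "pprt (- a) * pprt (- x) \<in> H"
      "pprt a * pprt (- x) \<in> H" "pprt (- a) * pprt x \<in> H"
      by (rule mem; simp)+
    have nn: "0 \<le> pprt b * pprt y" for b y :: 'u by (simp add: mult_nonneg_nonneg)
    let ?y = "pprt a * pprt x + pprt (- a) * pprt (- x)"
    let ?z = "pprt a * pprt (- x) + pprt (- a) * pprt x"
    have "a * x = (pprt a - pprt (- a)) * (pprt x - pprt (- x))"
      using diff_pprts[of a] diff_pprts[of x] by simp
    also have "\<dots> = ?y - ?z" by (simp add: algebra_simps)
    finally have "V (a * x) = p ?y - p ?z"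
      using Vdiff[of ?y ?z] m nn by (simp add: L2_add add_nonneg_nonneg)
    also have "\<dots> = (pprt a - pprt (- a)) * (p (pprt x) - p (pprt (- x)))"
      using m nn pa px by (simp add: padd phom left_diff_distrib right_diff_distrib)
    also have "\<dots> = a * V x" using x diff_pprts[of a] by (simp add: V_def)
    finally show ?thesis .
  qed
  \<comment> \<open>The constant of \<open>P\<close> serves again: the absolute value of
    \<open>V x\<close> is at most \<open>P\<close> applied to the absolute value of
    \<open>x\<close>, whose norm is that of \<open>x\<close>.\<close>
  have Vb: "\<exists>k\<in>A. 0 \<le> k \<and> (\<forall>x\<in>H. \<nu> (V x) \<le> k * \<nu> x)"
  proof -
    obtain k where k: "k \<in> A" "0 \<le> k" "\<And>x. x \<in> H \<Longrightarrow> \<nu> (P x) \<le> k * \<nu> x"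
      using bounded_opsD(5)[OF PB] by blast
    have "\<nu> (V x) \<le> k * \<nu> x" if x: "x \<in> H" for x
    proof -
      let ?w = "sup x (- x)"
      have w: "?w \<in> H" using x by (rule L2_sup_uminus)
      note px = parts[OF x]
      have le: "p (pprt x) \<le> P ?w" "p (pprt (- x)) \<le> P ?w"
      proof -
        have "P (pprt x) \<le> P ?w" "P (pprt (- x)) \<le> P ?w"
          using px w by (auto intro!: positive_ops_mono[OF P] simp: sup_uminus_eq_pprts)
        then show "p (pprt x) \<le> P ?w" "p (pprt (- x)) \<le> P ?w"
          using pP[OF px(1)] pP[OF px(2)] by (auto intro: order_trans)
      qed
      have nn: "0 \<le> p (pprt x)" "0 \<le> p (pprt (- x))" using px p0 by auto
      have "\<nu> (V x) \<le> \<nu> (P ?w)"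
      proof (rule norm_T2_mono)
        show "P ?w \<in> H" using w bounded_opsD(2)[OF PB] by blast
        show "V x \<le> P ?w" using le(1) nn(2) x by (simp add: V_def diff_le_eq add_increasing2)
        show "- V x \<le> P ?w" using le(2) nn(1) x by (simp add: V_def diff_le_eq add_increasing2)
      qed
      also have "\<dots> \<le> k * \<nu> ?w" by (rule k(3)[OF w])
      finally show ?thesis by (simp only: norm_T2_sup_uminus)
    qed
    then show ?thesis using k by blast
  qed
  have "V \<in> \<B>"
    unfolding bounded_ops_def mem_Collect_eq
    using VH Vadd Vhom Vb by (auto simp: V_def[of x for x])
  then have "V \<in> \<P>" using Vp p0 by (simp add: positive_ops_def order_positive_def)
  then show ?thesis using Vp by blast
qed

text \<open>The Riesz--Kantorovich formula. For homogeneity, an element \<open>y\<close> below \<open>a * x\<close> is written as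
  \<open>(a + \<epsilon>) * z\<close> with \<open>z\<close> below \<open>x\<close>.\<close>

lemma positive_part:
  assumes W: "W \<in> \<R>"
  shows "\<exists>V\<in>\<P>. is_sup_on (op_le E T) \<R> {W, \<lambda>x. 0} V"
proof -
  obtain P Q where PQ: "P \<in> \<P>" "Q \<in> \<P>" and WPQ: "W = (\<lambda>x. P x - Q x)"
    using W by (rule regular_opsE)
  have WB: "W \<in> \<B>" using W by (rule regular_in_bounded_ops)
  define p where "p x = Sup (W ` {0..x})" for x
  have inH: "y \<in> H" if "x \<in> H" "y \<in> {0..x}" for x y
    using that by (auto intro: L2_nonneg_ideal)
  have WP: "W y \<le> P x" if "x \<in> H" "y \<in> {0..x}" for x y
  proof -
    have y: "y \<in> H" "0 \<le> y" "y \<le> x" using that inH by auto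
    have "W y \<le> P y" using WPQ positive_opsD(2)[OF PQ(2) y(1,2)] by simp
    also have "\<dots> \<le> P x" using y that by (intro positive_ops_mono[OF PQ(1)])
    finally show ?thesis .
  qed
  have bd: "bdd_above (W ` {0..x})" if "x \<in> H" for x
    using WP[OF that] by (rule bdd_aboveI2)
  have up: "W y \<le> p x" if "x \<in> H" "y \<in> {0..x}" for x y
    unfolding p_def using that bd by (intro cSup_upper) auto
  have least: "p x \<le> u" if "0 \<le> x" "\<And>y. y \<in> {0..x} \<Longrightarrow> W y \<le> u" for x u
    unfolding p_def using that by (intro cSup_least) auto
  have p0: "0 \<le> p x" if "x \<in> H" "0 \<le> x" for x
    using up[of x 0] that bounded_ops_zero_arg[OF WB] by simp
  have padd: "p (x + y) = p x + p y" if x: "x \<in> H" "0 \<le> x" and y: "y \<in> H" "0 \<le> y" for x y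
  proof (rule order.antisym)
    have xy: "x + y \<in> H" using x y by (intro L2_add)
    show "p (x + y) \<le> p x + p y"
    proof (rule least)
      fix z assume z: "z \<in> {0..x + y}"
      \<comment> \<open>Riesz decomposition: this piece lies below \<open>x\<close>, and what
        remains of \<open>z\<close> lies below \<open>y\<close>.\<close>
      let ?z = "inf z x"
      have z1: "?z \<in> {0..x}" using z x by auto
      have z2: "z - ?z \<in> {0..y}"
      proof -
        have "z - y \<le> z" "z - y \<le> x" using z y by (simp_all add: diff_le_eq)
        then have "z - y \<le> ?z" by (rule le_infI)
        then have "z - ?z \<le> y" by (simp only: diff_le_eq add.commute)
        then show ?thesis by simp
      qed
      have "W z = W ?z + W (z - ?z)"
        using bounded_opsD(3)[OF WB, of ?z "z - ?z"] inH[OF x(1) z1] inH[OF y(1) z2] by simp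
      also have "\<dots> \<le> p x + p y" using up[OF x(1) z1] up[OF y(1) z2] by (rule add_mono)
      finally show "W z \<le> p x + p y" .
    qed (use x y in \<open>simp add: add_nonneg_nonneg\<close>)
    have *: "W u + W v \<le> p (x + y)" if "u \<in> {0..x}" "v \<in> {0..y}" for u v
    proof -
      have "u + v \<in> {0..x + y}" using that by (auto intro: add_mono add_nonneg_nonneg)
      then have "W (u + v) \<le> p (x + y)" by (rule up[OF xy])
      then show ?thesis
        using bounded_opsD(3)[OF WB] inH[OF x(1) that(1)] inH[OF y(1) that(2)] by simp
    qed
    have "p x \<le> p (x + y) - W v" if "v \<in> {0..y}" for v
      by (rule least[OF x(2)]) (use * that in \<open>simp add: le_diff_eq\<close>)
    then have "p y \<le> p (x + y) - p x"
      by (intro least[OF y(2)]) (simp add: le_diff_eq add.commute)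
    then show "p x + p y \<le> p (x + y)" by (simp add: le_diff_eq add.commute)
  qed
  have phom: "p (a * x) = a * p x"
    if a: "a \<in> A" "0 \<le> a" and x: "x \<in> H" "0 \<le> x" and ax: "a * x \<in> H" for a x
  proof (rule order.antisym)
    show "a * p x \<le> p (a * x)"
      unfolding p_def[of x]
    proof (rule mult_cSup[OF _ bd[OF x(1)] a(2)])
      show "W ` {0..x} \<noteq> {}" using x by auto
      fix s assume "s \<in> W ` {0..x}"
      then obtain y where y: "y \<in> {0..x}" "s = W y" by blast
      have "a * y \<in> {0..a * x}" using y a by (auto intro: mult_left_mono mult_nonneg_nonneg)
      then have "W (a * y) \<le> p (a * x)" by (rule up[OF ax])
      then show "a * s \<le> p (a * x)" using bounded_opsD(4)[OF WB a(1) inH[OF x(1) y(1)]] y by simp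
    qed
    show "p (a * x) \<le> a * p x"
    \<comment> \<open>Dividing by \<open>a + \<epsilon>\<close> in place of \<open>a\<close> costs
      \<open>\<epsilon> *\<^sub>R p x\<close>, where \<open>p x\<close> does not depend on
      \<open>\<epsilon>\<close>.\<close>
    proof (rule archimedean_eps_add[where y = "p x"])
      fix \<epsilon> :: real assume eps: "0 < \<epsilon>"
      show "p (a * x) \<le> a * p x + \<epsilon> *\<^sub>R p x"
      proof (rule least)
        fix y assume y: "y \<in> {0..a * x}"
        obtain z where z: "0 \<le> z" "a * z + \<epsilon> *\<^sub>R z = y" using division[OF eps a(2)] y by auto
        have az: "0 \<le> a * z" "0 \<le> \<epsilon> *\<^sub>R z"
          using a z eps by (auto intro: mult_nonneg_nonneg scaleR_nonneg_nonneg)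
        \<comment> \<open>\<open>?c * (z - x)\<close> is nonpositive, so \<open>?c\<close>
          annihilates the excess \<open>?d\<close>. Both summands of \<open>?c * ?d\<close> are
          nonnegative, hence already \<open>\<epsilon> *\<^sub>R ?d\<close> is zero.\<close>
        have "z \<le> x"
        proof -
          let ?c = "a + \<epsilon> *\<^sub>R e" and ?d = "pprt (z - x)"
          have c: "0 \<le> ?c"
            using a eps unit_nonneg by (intro add_nonneg_nonneg scaleR_nonneg_nonneg) auto
          have "?c * (z - x) = y - a * x - \<epsilon> *\<^sub>R x"
            unfolding z(2)[symmetric] by (simp add: algebra_simps)
          also have "\<dots> \<le> 0"
            using y scaleR_nonneg_nonneg[OF less_imp_le[OF eps] x(2)]
            by (simp add: diff_le_eq add_increasing)
          finally have "?c * ?d = 0" using mult_pprt[OF c, of "z - x"] by simp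
          then have "a * ?d + \<epsilon> *\<^sub>R ?d = 0" by (simp add: distrib_right)
          moreover have "0 \<le> a * ?d" "0 \<le> \<epsilon> *\<^sub>R ?d"
            using a eps by (auto intro: mult_nonneg_nonneg scaleR_nonneg_nonneg)
          ultimately have "\<epsilon> *\<^sub>R ?d = 0" by (simp add: add_nonneg_eq_0_iff)
          then have "?d = 0" using eps by simp
          then show ?thesis by (simp add: le_zero_iff_zero_pprt[symmetric])
        qed
        then have zx: "z \<in> {0..x}" using z by simp
        have zH: "z \<in> H" using inH[OF x(1) zx] .
        \<comment> \<open>Additivity of \<open>W\<close> splits the value at \<open>y\<close> only
          when both summands of \<open>y\<close> lie in \<open>H\<close>.\<close>
        have azH: "a * z \<in> H"
        proof (rule inH[OF ax])
          show "a * z \<in> {0..a * x}" using az zx a by (auto intro: mult_left_mono)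
        qed
        have "W y = a * W z + \<epsilon> *\<^sub>R W z"
          unfolding z(2)[symmetric]
          using bounded_opsD(3)[OF WB azH L2_scaleR[OF zH]] bounded_opsD(4)[OF WB a(1) zH]
            bounded_ops_scaleR_arg[OF WB zH] by simp
        also have "\<dots> \<le> a * p x + \<epsilon> *\<^sub>R p x"
          using up[OF x(1) zx] a eps by (intro add_mono mult_left_mono scaleR_left_mono) auto
        finally show "W y \<le> a * p x + \<epsilon> *\<^sub>R p x" .
      qed (use a x in \<open>simp add: mult_nonneg_nonneg\<close>)
    qed
  qed
  have pP: "p x \<le> P x" if "x \<in> H" "0 \<le> x" for x
    using that WP by (intro least)
  obtain V where V: "V \<in> \<P>" "\<And>x. x \<in> H \<Longrightarrow> 0 \<le> x \<Longrightarrow> V x = p x"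
    using positive_op_extension[OF PQ(1) p0 pP padd phom] by blast
  have "is_sup_on (op_le E T) \<R> {W, \<lambda>x. 0} V"
    unfolding is_sup_on_def
  proof (intro conjI ballI impI)
    show "V \<in> \<R>" using V(1) by (rule positive_in_regular_ops)
    show "op_le E T d V" if "d \<in> {W, \<lambda>x. 0}" for d
      using that V(2) p0 up by (auto simp: op_le_iff)
    fix U assume U: "U \<in> \<R>" "\<forall>d\<in>{W, \<lambda>x. 0}. op_le E T d U"
    then have UP: "U \<in> \<P>" by (intro regular_op_positive) (auto simp: op_le_iff)
    show "op_le E T V U"
      unfolding op_le_iff
    proof (intro ballI impI)
      fix x assume x: "x \<in> H" "0 \<le> x"
      have "p x \<le> U x"
      proof (rule least[OF x(2)])
        fix y assume y: "y \<in> {0..x}"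
        have "W y \<le> U y" using U y inH[OF x(1) y] by (auto simp: op_le_iff)
        also have "\<dots> \<le> U x" using y inH[OF x(1) y] x by (intro positive_ops_mono[OF UP]) auto
        finally show "W y \<le> U x" .
      qed
      then show "V x \<le> U x" using V(2)[OF x] by simp
    qed
  qed
  then show ?thesis using V(1) by blast
qed

text \<open>Translation reduces the supremum to a positive part: it is \<open>R\<close> plus the
  positive part of \<open>Q - R\<close>.\<close>

lemma regular_sup:
  assumes "R \<in> \<R>" "Q \<in> \<R>"
  shows "\<exists>V. is_sup_on (op_le E T) \<R> {R, Q} V"
proof -
  obtain V where V: "V \<in> \<P>" "is_sup_on (op_le E T) \<R> {\<lambda>x. Q x - R x, \<lambda>x. 0} V"
    using positive_part[OF regular_ops_diff[OF assms(2,1)]] by blast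
  have "is_sup_on (op_le E T) \<R> {R, Q} (\<lambda>x. R x + V x)"
    unfolding is_sup_on_def
  proof (intro conjI ballI impI)
    show "(\<lambda>x. R x + V x) \<in> \<R>"
      by (rule regular_ops_add[OF assms(1) positive_in_regular_ops[OF V(1)]])
    show "op_le E T d (\<lambda>x. R x + V x)" if "d \<in> {R, Q}" for d
      using that V(2) by (auto simp: is_sup_on_def op_le_iff diff_le_eq add.commute)
    fix U assume U: "U \<in> \<R>" "\<forall>d\<in>{R, Q}. op_le E T d U"
    have "op_le E T V (\<lambda>x. U x - R x)"
      using V(2) regular_ops_diff[OF U(1) assms(1)] U(2)
      by (auto simp: is_sup_on_def op_le_iff)
    then show "op_le E T (\<lambda>x. R x + V x) U"
      by (auto simp: op_le_iff le_diff_eq add.commute)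
  qed
  then show ?thesis by blast
qed

section \<open>Reflection of infima and suprema of directed sets\<close>

lemma op_le_uminus: "op_le E T (\<lambda>x. - R x) (\<lambda>x. - Q x) \<longleftrightarrow> op_le E T Q R"
  by (simp add: op_le_iff)

text \<open>Pointwise negation is an order-reversing involution of \<open>\<R>\<close>, so
  quantification over candidate bounds can be reindexed by it.\<close>

lemma is_inf_on_regular_iff:
  assumes D: "D \<subseteq> \<R>"
  shows "is_inf_on (op_le E T) \<R> D S \<longleftrightarrow>
    is_sup_on (op_le E T) \<R> ((\<lambda>R x. - R x) ` D) (\<lambda>x. - S x)"
proof -
  have mem: "(\<lambda>x. - R x) \<in> \<R> \<longleftrightarrow> R \<in> \<R>" for R
    using regular_ops_uminus[of R] regular_ops_uminus[of "\<lambda>x. - R x"] by auto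
  have all: "(\<forall>U\<in>\<R>. \<phi> U) \<longleftrightarrow> (\<forall>U\<in>\<R>. \<phi> (\<lambda>x. - U x))" for \<phi>
  proof
    assume *: "\<forall>U\<in>\<R>. \<phi> (\<lambda>x. - U x)"
    show "\<forall>U\<in>\<R>. \<phi> U"
    proof
      fix U assume "U \<in> \<R>"
      then have "\<phi> (\<lambda>x. - (- U x))" by (rule *[rule_format, OF regular_ops_uminus])
      then show "\<phi> U" by simp
    qed
  qed (use regular_ops_uminus in blast)
  show ?thesis
    unfolding is_inf_on_def is_sup_on_def
    by (subst (2) all) (simp add: mem op_le_uminus)
qed

text \<open>After subtraction of a fixed member \<open>R0\<close>, the pointwise supremum is
  nonnegative and dominated by the positive operator \<open>U - R0\<close>, so
  \<open>positive_op_extension\<close> applies.\<close>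

lemma regular_directed_sup:
  assumes D: "D \<subseteq> \<R>" "directed_on (op_le E T) D" and bd: "bdd_above_on (op_le E T) \<R> D"
  shows "\<exists>S. is_sup_on (op_le E T) \<R> D S \<and>
    (\<forall>x\<in>H. 0 \<le> x \<longrightarrow> is_sup_on (\<le>) H ((\<lambda>R. R x) ` D) (S x))"
proof -
  obtain U where U: "U \<in> \<R>" "\<And>R. R \<in> D \<Longrightarrow> op_le E T R U"
    using bd by (auto simp: bdd_above_on_def)
  obtain R0 where R0: "R0 \<in> D" using directed_on_nonempty[OF D(2)] by blast
  \<comment> \<open>Directedness makes these members cofinal in \<open>D\<close>, and their
    differences from \<open>R0\<close> are order positive.\<close>
  define D' where "D' = {R \<in> D. op_le E T R0 R}"
  have R0D': "R0 \<in> D'" using R0 by (simp add: D'_def op_le_iff)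
  have DB: "R \<in> \<B>" if "R \<in> D" for R using that D(1) regular_in_bounded_ops by blast
  have D'D: "R \<in> D" if "R \<in> D'" for R using that by (simp add: D'_def)
  have PU: "(\<lambda>x. U x - R0 x) \<in> \<P>"
    using regular_ops_diff[OF U(1), of R0] R0 D(1) U(2)[OF R0]
    by (intro regular_op_positive) (auto simp: op_le_iff)
  define p where "p x = Sup ((\<lambda>R. R x - R0 x) ` D')" for x
  have UR: "R x - R0 x \<le> U x - R0 x" if "x \<in> H" "0 \<le> x" "R \<in> D" for R x
    using U(2)[OF that(3)] that by (auto simp: op_le_iff)
  have bdp: "bdd_above ((\<lambda>R. R x - R0 x) ` D')" if "x \<in> H" "0 \<le> x" for x
    using UR[OF that D'D] by (rule bdd_aboveI2)
  have up: "R x - R0 x \<le> p x" if "x \<in> H" "0 \<le> x" "R \<in> D'" for R x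
    unfolding p_def using that bdp by (intro cSup_upper) auto
  have least: "p x \<le> u" if "\<And>R. R \<in> D' \<Longrightarrow> R x - R0 x \<le> u" for x u
    unfolding p_def using that R0D' by (intro cSup_least) auto
  have p0: "0 \<le> p x" if "x \<in> H" "0 \<le> x" for x
    using up[OF that R0D'] by simp
  have pP: "p x \<le> U x - R0 x" if "x \<in> H" "0 \<le> x" for x
    using UR[OF that D'D] by (rule least)
  have padd: "p (x + y) = p x + p y" if x: "x \<in> H" "0 \<le> x" and y: "y \<in> H" "0 \<le> y" for x y
  proof (rule order.antisym)
    have Radd: "R (x + y) - R0 (x + y) = (R x - R0 x) + (R y - R0 y)" if "R \<in> D'" for R
      using bounded_opsD(3)[OF DB[OF D'D[OF that]] x(1) y(1)]
        bounded_opsD(3)[OF DB[OF R0] x(1) y(1)] by simp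
    show "p (x + y) \<le> p x + p y"
      using up[OF x] up[OF y] by (intro least) (simp only: Radd add_mono)
    \<comment> \<open>The values at \<open>x\<close> and \<open>y\<close> may be approached along
      different members; directedness replaces both by a common \<open>V\<close>.\<close>
    have *: "(R x - R0 x) + (Q y - R0 y) \<le> p (x + y)" if RQ: "R \<in> D'" "Q \<in> D'" for R Q
    proof -
      obtain V where V: "V \<in> D" "op_le E T R V" "op_le E T Q V"
        using directed_onD[OF D(2) D'D[OF RQ(1)] D'D[OF RQ(2)]] by blast
      have VD': "V \<in> D'"
        using V RQ(1) by (auto simp: D'_def op_le_iff intro: order_trans)
      have "R x - R0 x \<le> V x - R0 x" "Q y - R0 y \<le> V y - R0 y"
        using V x y by (auto simp: op_le_iff)
      then have "(R x - R0 x) + (Q y - R0 y) \<le> V (x + y) - R0 (x + y)"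
        unfolding Radd[OF VD'] by (rule add_mono)
      also have "\<dots> \<le> p (x + y)"
        using x y by (intro up VD' L2_add add_nonneg_nonneg)
      finally show ?thesis .
    qed
    have "p x \<le> p (x + y) - (Q y - R0 y)" if "Q \<in> D'" for Q
      using *[OF _ that] by (intro least) (simp only: le_diff_eq)
    then have "(Q y - R0 y) + p x \<le> p (x + y)" if "Q \<in> D'" for Q
      using that by (simp only: le_diff_eq add.commute)
    then have "p y \<le> p (x + y) - p x" by (intro least) (simp only: le_diff_eq)
    then show "p x + p y \<le> p (x + y)" by (simp add: le_diff_eq add.commute)
  qed
  have phom: "p (a * x) = a * p x"
    if a: "a \<in> A" "0 \<le> a" and x: "x \<in> H" "0 \<le> x" and ax: "a * x \<in> H" for a x
  proof (rule order.antisym)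
    have hom: "R (a * x) - R0 (a * x) = a * (R x - R0 x)" if "R \<in> D'" for R
      using bounded_opsD(4)[OF DB[OF D'D[OF that]] a(1) x(1)]
        bounded_opsD(4)[OF DB[OF R0] a(1) x(1)] by (simp add: right_diff_distrib)
    show "p (a * x) \<le> a * p x"
      using up[OF x] a(2) by (intro least) (simp only: hom mult_left_mono)
    show "a * p x \<le> p (a * x)"
      unfolding p_def[of x]
    proof (rule mult_cSup[OF _ bdp[OF x] a(2)])
      show "(\<lambda>R. R x - R0 x) ` D' \<noteq> {}" using R0D' by blast
      fix s assume "s \<in> (\<lambda>R. R x - R0 x) ` D'"
      then obtain R where R: "R \<in> D'" "s = R x - R0 x" by blast
      have "0 \<le> a * x" using a x by (intro mult_nonneg_nonneg)
      then have "R (a * x) - R0 (a * x) \<le> p (a * x)" using up[OF ax _ R(1)] by simp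
      then show "a * s \<le> p (a * x)" using hom[OF R(1)] R(2) by simp
    qed
  qed
  obtain V where V: "V \<in> \<P>" "\<And>x. x \<in> H \<Longrightarrow> 0 \<le> x \<Longrightarrow> V x = p x"
    using positive_op_extension[OF PU p0 pP padd phom] by blast
  define S where "S x = R0 x + V x" for x
  have SR: "S \<in> \<R>"
    unfolding S_def using R0 D(1) by (intro regular_ops_add positive_in_regular_ops[OF V(1)]) auto
  \<comment> \<open>A member that is not above \<open>R0\<close> is dominated by one that
    is.\<close>
  have Sup: "R x \<le> S x" if x: "x \<in> H" "0 \<le> x" and R: "R \<in> D" for R x
  proof -
    obtain Q where Q: "Q \<in> D" "op_le E T R Q" "op_le E T R0 Q"
      using directed_onD[OF D(2) R R0] by blast
    then have "R x \<le> Q x" using x by (simp add: op_le_iff)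
    also have "\<dots> = R0 x + (Q x - R0 x)" by simp
    also have "\<dots> \<le> S x"
      unfolding S_def V(2)[OF x] using Q by (intro add_left_mono up x) (simp add: D'_def)
    finally show ?thesis .
  qed
  have Sleast: "S x \<le> u" if x: "x \<in> H" "0 \<le> x" and u: "\<And>R. R \<in> D \<Longrightarrow> R x \<le> u" for x u
  proof -
    have "p x \<le> u - R0 x" using u D'D by (intro least) simp
    then show ?thesis unfolding S_def V(2)[OF x] by (simp add: le_diff_eq add.commute)
  qed
  have "is_sup_on (op_le E T) \<R> D S"
    unfolding is_sup_on_def using SR Sup Sleast by (auto simp: op_le_iff)
  \<comment> \<open>\<open>Sleast\<close> compares with upper bounds from the whole type, so
    membership of \<open>S x\<close> in \<open>H\<close> is all that remains for the supremum in
    \<open>H\<close>.\<close>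
  moreover have "is_sup_on (\<le>) H ((\<lambda>R. R x) ` D) (S x)" if "x \<in> H" "0 \<le> x" for x
    unfolding is_sup_on_def
    using Sup[OF that] Sleast[OF that] bounded_opsD(2)[OF regular_in_bounded_ops[OF SR] that(1)]
    by auto
  ultimately show ?thesis by blast
qed

section \<open>The vector lattice of regular operators and suprema of families\<close>

lemma op_le_refl: "op_le E T R R"
  by (simp add: op_le_iff)

lemma op_le_trans: "op_le E T R Q \<Longrightarrow> op_le E T Q V \<Longrightarrow> op_le E T R V"
  by (auto simp: op_le_iff intro: order_trans)

lemma regular_ops_vector_lattice: "operator_vector_lattice (op_le E T) \<R>"
  unfolding operator_vector_lattice_def
proof (intro conjI ballI allI impI)
  show "(\<lambda>x. 0) \<in> \<R>" by (intro positive_in_regular_ops zero_in_positive_ops)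
  fix R Q assume RQ: "R \<in> \<R>" "Q \<in> \<R>"
  show "\<exists>V. is_sup_on (op_le E T) \<R> {R, Q} V" using RQ by (rule regular_sup)
  \<comment> \<open>The infimum is the negative of the supremum of the negatives.\<close>
  obtain V where V: "is_sup_on (op_le E T) \<R> {\<lambda>x. - R x, \<lambda>x. - Q x} V"
    using regular_sup[OF regular_ops_uminus regular_ops_uminus, OF RQ] by blast
  then have "is_inf_on (op_le E T) \<R> {R, Q} (\<lambda>x. - V x)"
    using RQ by (subst is_inf_on_regular_iff) auto
  then show "\<exists>V. is_inf_on (op_le E T) \<R> {R, Q} V" by blast
  show "op_le E T R V" if "op_le E T R Q" "op_le E T Q V" for V
    using that by (rule op_le_trans)
qed (auto intro: regular_ops_add regular_ops_scaleR op_le_refl op_le_antisym op_le_trans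
    simp: op_le_iff scaleR_left_mono)

text \<open>A bound of \<open>F\<close> also bounds its finite suprema, so the directed case applies
  to them. Equality of the upper bounds then carries the supremum back to \<open>F\<close>.\<close>

lemma regular_family_sup:
  assumes F: "F \<subseteq> \<R>" "F \<noteq> {}" "bdd_above_on (op_le E T) \<R> F"
  shows "\<And>G. finite G \<Longrightarrow> G \<noteq> {} \<Longrightarrow> G \<subseteq> F \<Longrightarrow> \<exists>V. is_sup_on (op_le E T) \<R> G V"
    and "directed_on (op_le E T) (finite_sups (op_le E T) \<R> F)"
    and "\<exists>S. is_sup_on (op_le E T) \<R> F S \<and>
      is_sup_on (op_le E T) \<R> (finite_sups (op_le E T) \<R> F) S"
proof -
  show "\<exists>V. is_sup_on (op_le E T) \<R> G V" if "finite G" "G \<noteq> {}" "G \<subseteq> F" for G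
    by (rule finite_sup_exists[OF op_le_trans regular_sup]) (use that F in auto)
  show dir: "directed_on (op_le E T) (finite_sups (op_le E T) \<R> F)"
    by (rule finite_sups_directed[OF op_le_refl op_le_trans regular_sup]) (use F in auto)
  have sub: "finite_sups (op_le E T) \<R> F \<subseteq> \<R>"
    by (auto simp: finite_sups_def is_sup_on_def)
  have "bdd_above_on (op_le E T) \<R> (finite_sups (op_le E T) \<R> F)"
    using F(3) unfolding bdd_above_on_def finite_sups_def is_sup_on_def by blast
  then obtain S where S: "is_sup_on (op_le E T) \<R> (finite_sups (op_le E T) \<R> F) S"
    using regular_directed_sup[OF sub dir] by blast
  moreover have "is_sup_on (op_le E T) \<R> F S"
  proof -
    have "is_sup_on (op_le E T) \<R> (finite_sups (op_le E T) \<R> F) S \<longleftrightarrow>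
        is_sup_on (op_le E T) \<R> F S"
      by (rule is_sup_on_finite_sups_iff) (use F(1) op_le_trans regular_sup in blast)+
    then show ?thesis using S by simp
  qed
  ultimately show "\<exists>S. is_sup_on (op_le E T) \<R> F S \<and>
      is_sup_on (op_le E T) \<R> (finite_sups (op_le E T) \<R> F) S" by blast
qed

section \<open>Pointwise suprema and infima of monotone nets\<close>

lemma regular_net_sup:
  assumes I: "directed_on leq I"
    and S: "\<And>i. i \<in> I \<Longrightarrow> S i \<in> \<R>"
    and mono: "\<And>i j. i \<in> I \<Longrightarrow> j \<in> I \<Longrightarrow> leq i j \<Longrightarrow> op_le E T (S i) (S j)"
    and S0: "is_sup_on (op_le E T) \<R> (S ` I) S0"
    and x: "x \<in> H" "0 \<le> x"
  shows "is_sup_on (\<le>) H ((\<lambda>i. S i x) ` I) (S0 x)"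
proof -
  have "directed_on (op_le E T) (S ` I)"
    unfolding directed_on_def
  proof (intro conjI ballI impI)
    show "S ` I \<noteq> {}" using directed_on_nonempty[OF I] by simp
    fix R Q assume "R \<in> S ` I" "Q \<in> S ` I"
    then obtain i j where ij: "i \<in> I" "j \<in> I" "R = S i" "Q = S j" by blast
    then obtain k where "k \<in> I" "leq i k" "leq j k" using directed_onD[OF I] by blast
    then show "\<exists>V\<in>S ` I. op_le E T R V \<and> op_le E T Q V" using ij mono by blast
  qed (auto intro: op_le_refl op_le_trans)
  moreover have "bdd_above_on (op_le E T) \<R> (S ` I)"
    using S0 unfolding bdd_above_on_def is_sup_on_def by blast
  moreover have "S ` I \<subseteq> \<R>" using S by blast
  ultimately have "\<exists>S'. is_sup_on (op_le E T) \<R> (S ` I) S' \<and>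
      (\<forall>x\<in>H. 0 \<le> x \<longrightarrow> is_sup_on (\<le>) H ((\<lambda>R. R x) ` S ` I) (S' x))"
    by (intro regular_directed_sup)
  then obtain S' where S': "is_sup_on (op_le E T) \<R> (S ` I) S'"
    "\<And>x. x \<in> H \<Longrightarrow> 0 \<le> x \<Longrightarrow> is_sup_on (\<le>) H ((\<lambda>R. R x) ` S ` I) (S' x)"
    by blast
  \<comment> \<open>Antisymmetry on \<open>\<R>\<close> identifies the given supremum with the
    operator constructed pointwise.\<close>
  have "S' = S0" using S'(1) S0 by (rule op_sup_unique)
  then show ?thesis using S'(2)[OF x] by (simp add: image_image)
qed

lemma regular_net_inf:
  assumes I: "directed_on leq I"
    and S: "\<And>i. i \<in> I \<Longrightarrow> S i \<in> \<R>"
    and mono: "\<And>i j. i \<in> I \<Longrightarrow> j \<in> I \<Longrightarrow> leq i j \<Longrightarrow> op_le E T (S j) (S i)"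
    and S0: "is_inf_on (op_le E T) \<R> (S ` I) S0"
    and x: "x \<in> H" "0 \<le> x"
  shows "is_inf_on (\<le>) H ((\<lambda>i. S i x) ` I) (S0 x)"
proof -
  have "is_sup_on (op_le E T) \<R> ((\<lambda>i x. - S i x) ` I) (\<lambda>x. - S0 x)"
    using S0 S by (subst (asm) is_inf_on_regular_iff) (auto simp: image_image)
  then have s: "is_sup_on (\<le>) H ((\<lambda>i. - S i x) ` I) (- S0 x)"
    by (rule regular_net_sup[OF I, rotated 2])
      (use S mono x in \<open>auto simp: op_le_uminus intro: regular_ops_uminus\<close>)
  show ?thesis
    unfolding is_inf_on_def
  proof (intro conjI ballI impI)
    show "S0 x \<in> H" using s L2_uminus[of "- S0 x"] by (auto simp: is_sup_on_def)
    show "S0 x \<le> d" if "d \<in> (\<lambda>i. S i x) ` I" for d using s that by (auto simp: is_sup_on_def)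
    fix u assume u: "u \<in> H" "\<forall>d\<in>(\<lambda>i. S i x) ` I. u \<le> d"
    then have "- u \<in> H" "\<forall>d\<in>(\<lambda>i. - S i x) ` I. d \<le> - u" using L2_uminus by auto
    then have "- S0 x \<le> - u" using s unfolding is_sup_on_def by blast
    then show "u \<le> S0 x" by simp
  qed
qed

end

theorem theorem9p11:
  fixes E :: "'u::dedekind_complete_f_algebra set" and e :: 'u and T :: "'u \<Rightarrow> 'u"
  assumes "riesz_conditional_expectation E e T"
  shows
    "operator_vector_lattice (op_le E T) (regular_ops E T) \<and>
     dedekind_complete_on (op_le E T) (regular_ops E T) \<and>
     (\<forall>(I :: 'i set) leq (S :: 'i \<Rightarrow> 'u \<Rightarrow> 'u) S0.
        directed_on leq I \<and>
        (\<forall>i\<in>I. S i \<in> regular_ops E T) \<and>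
        (\<forall>i\<in>I. \<forall>j\<in>I. leq i j \<longrightarrow> op_le E T (S i) (S j)) \<and>
        bdd_above_on (op_le E T) (regular_ops E T) (S ` I) \<and>
        is_sup_on (op_le E T) (regular_ops E T) (S ` I) S0 \<longrightarrow>
        (\<forall>x\<in>L2 E T. 0 \<le> x \<longrightarrow> is_sup_on (\<le>) (L2 E T) ((\<lambda>i. S i x) ` I) (S0 x))) \<and>
     (\<forall>(I :: 'i set) leq (S :: 'i \<Rightarrow> 'u \<Rightarrow> 'u) S0.
        directed_on leq I \<and>
        (\<forall>i\<in>I. S i \<in> regular_ops E T) \<and>
        (\<forall>i\<in>I. \<forall>j\<in>I. leq i j \<longrightarrow> op_le E T (S j) (S i)) \<and>
        bdd_below_on (op_le E T) (regular_ops E T) (S ` I) \<and>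
        is_inf_on (op_le E T) (regular_ops E T) (S ` I) S0 \<longrightarrow>
        (\<forall>x\<in>L2 E T. 0 \<le> x \<longrightarrow> is_inf_on (\<le>) (L2 E T) ((\<lambda>i. S i x) ` I) (S0 x))) \<and>
     (\<forall>F. F \<subseteq> regular_ops E T \<and> F \<noteq> {} \<and> bdd_above_on (op_le E T) (regular_ops E T) F \<longrightarrow>
        (\<forall>G. finite G \<and> G \<noteq> {} \<and> G \<subseteq> F \<longrightarrow>
           (\<exists>V. is_sup_on (op_le E T) (regular_ops E T) G V)) \<and>
        directed_on (op_le E T) (finite_sups (op_le E T) (regular_ops E T) F) \<and>
        (\<exists>S0. is_sup_on (op_le E T) (regular_ops E T) F S0 \<and>
           is_sup_on (op_le E T) (regular_ops E T)
             (finite_sups (op_le E T) (regular_ops E T) F) S0))"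
proof -
  interpret riesz_conditional_expectation E e T by (rule assms)
  show ?thesis
  proof (intro conjI allI impI ballI)
    show "operator_vector_lattice (op_le E T) \<R>" by (rule regular_ops_vector_lattice)
    show "dedekind_complete_on (op_le E T) \<R>"
      unfolding dedekind_complete_on_def using regular_family_sup(3) by blast
  next
    fix I :: "'i set" and leq and S :: "'i \<Rightarrow> 'u \<Rightarrow> 'u" and S0 x
    assume *: "directed_on leq I \<and> (\<forall>i\<in>I. S i \<in> \<R>) \<and>
        (\<forall>i\<in>I. \<forall>j\<in>I. leq i j \<longrightarrow> op_le E T (S i) (S j)) \<and>
        bdd_above_on (op_le E T) \<R> (S ` I) \<and> is_sup_on (op_le E T) \<R> (S ` I) S0"
      and x: "x \<in> H" "0 \<le> x"
    show "is_sup_on (\<le>) H ((\<lambda>i. S i x) ` I) (S0 x)"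
      by (rule regular_net_sup[OF _ _ _ _ x, of leq]) (use * in blast)+
  next
    fix I :: "'i set" and leq and S :: "'i \<Rightarrow> 'u \<Rightarrow> 'u" and S0 x
    assume *: "directed_on leq I \<and> (\<forall>i\<in>I. S i \<in> \<R>) \<and>
        (\<forall>i\<in>I. \<forall>j\<in>I. leq i j \<longrightarrow> op_le E T (S j) (S i)) \<and>
        bdd_below_on (op_le E T) \<R> (S ` I) \<and> is_inf_on (op_le E T) \<R> (S ` I) S0"
      and x: "x \<in> H" "0 \<le> x"
    show "is_inf_on (\<le>) H ((\<lambda>i. S i x) ` I) (S0 x)"
      by (rule regular_net_inf[OF _ _ _ _ x, of leq]) (use * in blast)+
  next
    fix F assume F: "F \<subseteq> \<R> \<and> F \<noteq> {} \<and> bdd_above_on (op_le E T) \<R> F"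
    show "\<exists>V. is_sup_on (op_le E T) \<R> G V" if "finite G \<and> G \<noteq> {} \<and> G \<subseteq> F" for G
      using that F regular_family_sup(1)[of F G] by blast
    show "directed_on (op_le E T) (finite_sups (op_le E T) \<R> F)"
      using F regular_family_sup(2)[of F] by blast
    show "\<exists>S0. is_sup_on (op_le E T) \<R> F S0 \<and>
        is_sup_on (op_le E T) \<R> (finite_sups (op_le E T) \<R> F) S0"
      using F regular_family_sup(3)[of F] by blast
  qed
qed

end
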